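(* Let $f:\Omega_D\to\mathbb{O}$ be a slice Fueter-regular function. Suppose that either (1) $|f|$ attains a maximum at some point of $\Omega_D$, or (2) $|f|$ has a local maximum at some point of $\Omega_D\setminus V(f'_s)$. Then $f$ is constant.
   Context: Octonions $\mathbb{O}=\mathbb{H}+\ell\mathbb{H}$ (product $(a+\ell b)(c+\ell d)=(ac-d\bar b)+\ell(\bar a d+cb)$), identified with $\mathbb{R}^8$ with Euclidean norm $|\cdot|$; $\mathbb S=\{I:I^2=-1\}$. $D\subset\mathbb{R}^2$ non-empty open, invariant under $(x_0,x_1)\mapsto(x_0,-x_1)$, $\Omega_D=\{x_0+x_1I:(x_0,x_1)\in D,I\in\mathbb S\}$, assumed connected. Slice functions $f(x_0+x_1I)=F_1(x_0,x_1)+IF_2(x_0,x_1)$ with stem $(F_1,F_2)$, $F_1$ even and $F_2$ odd in $x_1$; spherical derivative $f'_s(x_0+x_1I)=F_2(x_0,x_1)/x_1$ on $\Omega_D\setminus\mathbb{R}$; $V(f'_s)=\{x\in\Omega_D\setminus\mathbb{R}:f'_s(x)=0\}$. Every slice Fueter-regular function is a slice function. Slice Fueter-regular: $E=\{(x_0,\dots,x_3):(x_0,(x_1^2+x_2^2+x_3^2)^{1/2})\in D\}$, $\mathcal N=\{(I,J)\in\mathbb S^2:I\perp J\}$, $O(3)$ the real orthogonal $4\times4$ matrices fixing the first basis vector acting by matrix–column multiplication; $f$ is slice Fueter-regular if there is $\mathcal F=(\mathcal F_0,\dots,\mathcal F_3):E\to\mathbb{O}^4$ of class $C^1$ with $\mathcal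 F(Av)=A\mathcal F(v)$, $f(x_0+x_1I+x_2J+x_3(IJ))=\mathcal F_0(v)+I\mathcal F_1(v)+J\mathcal F_2(v)+(IJ)\mathcal F_3(v)$ ($v\in E$, $(I,J)\in\mathcal N$), and $\partial_0\mathcal F_0-\partial_1\mathcal F_1-\partial_2\mathcal F_2-\partial_3\mathcal F_3=0$, $\partial_1\mathcal F_0+\partial_0\mathcal F_1-\partial_3\mathcal F_2+\partial_2\mathcal F_3=0$, $\partial_2\mathcal F_0+\partial_3\mathcal F_1+\partial_0\mathcal F_2-\partial_1\mathcal F_3=0$, $\partial_3\mathcal F_0-\partial_2\mathcal F_1+\partial_1\mathcal F_2+\partial_0\mathcal F_3=0$ on $E$. *)

theory Defs
  imports "HOL-Analysis.Analysis"
begin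

text \<open>A quaternion s + v (s real, v imaginary in R^3 with basis i,j,k) is the pair (s, v).\<close>
type_synonym quat = "real \<times> (real^3)"

definition qmul :: "quat \<Rightarrow> quat \<Rightarrow> quat" where
  "qmul p q = (fst p * fst q - snd p \<bullet> snd q,
               fst p *\<^sub>R snd q + fst q *\<^sub>R snd p + cross3 (snd p) (snd q))"

definition qcnj :: "quat \<Rightarrow> quat" where
  "qcnj q = (fst q, - snd q)"

text \<open>An octonion a + l b (a, b quaternions) is the pair (a, b); as a product of
  Euclidean spaces it carries the Euclidean norm of R^8.\<close>
type_synonym octo = "quat \<times> quat"

text \<open>(a + l b)(c + l d) = (a c - d conj(b)) + l (conj(a) d + c b)\<close>
definition omul :: "octo \<Rightarrow> octo \<Rightarrow> octo" (infixl \<open>\<odot>\<close> 70) where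
  "x \<odot> y = (qmul (fst x) (fst y) - qmul (snd y) (qcnj (snd x)),
             qmul (qcnj (fst x)) (snd y) + qmul (fst y) (snd x))"

definition oone :: octo where
  "oone = ((1, 0), (0, 0))"

definition oreal :: "real \<Rightarrow> octo" where
  "oreal r = r *\<^sub>R oone"

definition imag_units :: "octo set" where
  "imag_units = {I. I \<odot> I = - oone}"

definition OmegaD :: "(real \<times> real) set \<Rightarrow> octo set" where
  "OmegaD D = {oreal x0 + x1 *\<^sub>R I | x0 x1 I. (x0, x1) \<in> D \<and> I \<in> imag_units}"

definition is_stem :: "(real \<times> real) set \<Rightarrow> (octo \<Rightarrow> octo)
    \<Rightarrow> (real \<times> real \<Rightarrow> octo) \<Rightarrow> (real \<times> real \<Rightarrow> octo) \<Rightarrow> bool" where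
  "is_stem D f F1 F2 \<longleftrightarrow>
     (\<forall>x0 x1. (x0, x1) \<in> D \<longrightarrow> F1 (x0, - x1) = F1 (x0, x1) \<and> F2 (x0, - x1) = - F2 (x0, x1)) \<and>
     (\<forall>x0 x1 I. (x0, x1) \<in> D \<longrightarrow> I \<in> imag_units \<longrightarrow>
        f (oreal x0 + x1 *\<^sub>R I) = F1 (x0, x1) + I \<odot> F2 (x0, x1))"

definition sph_deriv :: "(real \<times> real) set \<Rightarrow> (octo \<Rightarrow> octo) \<Rightarrow> octo \<Rightarrow> octo" where
  "sph_deriv D f x = (THE w. \<exists>F1 F2 x0 x1 I. is_stem D f F1 F2 \<and> (x0, x1) \<in> D \<and>
       I \<in> imag_units \<and> x1 \<noteq> 0 \<and> x = oreal x0 + x1 *\<^sub>R I \<and> w = (1 / x1) *\<^sub>R F2 (x0, x1))"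

definition sph_zero_set :: "(real \<times> real) set \<Rightarrow> (octo \<Rightarrow> octo) \<Rightarrow> octo set" where
  "sph_zero_set D f = {x \<in> OmegaD D - range oreal. sph_deriv D f x = 0}"

text \<open>Coordinates (x0,x1,x2,x3) of R^4 are the components 1,2,3,4 of a vector in real^4.\<close>
definition Eset :: "(real \<times> real) set \<Rightarrow> (real^4) set" where
  "Eset D = {v. (v$1, sqrt ((v$2)^2 + (v$3)^2 + (v$4)^2)) \<in> D}"

definition Npairs :: "(octo \<times> octo) set" where
  "Npairs = {(I, J). I \<in> imag_units \<and> J \<in> imag_units \<and> I \<bullet> J = 0}"

definition O3 :: "(real^4^4) set" where
  "O3 = {A. orthogonal_matrix A \<and> A *v axis 1 1 = axis 1 1}"

definition mat_act :: "(real^4^4) \<Rightarrow> (octo^4) \<Rightarrow> (octo^4)" where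
  "mat_act A w = (\<chi> i. \<Sum>j\<in>UNIV. (A $ i $ j) *\<^sub>R (w $ j))"

text \<open>Partial derivative d_k F_j (k, j in {0..3}) given the (total) derivative F'.\<close>
definition pd :: "((real^4) \<Rightarrow>\<^sub>L (octo^4)) \<Rightarrow> nat \<Rightarrow> nat \<Rightarrow> octo" where
  "pd F' k j = blinfun_apply F' (axis (of_nat (k + 1)) 1) $ (of_nat (j + 1))"

definition slice_fueter_regular :: "(real \<times> real) set \<Rightarrow> (octo \<Rightarrow> octo) \<Rightarrow> bool" where
  "slice_fueter_regular D f \<longleftrightarrow>
    (\<exists>(F :: real^4 \<Rightarrow> octo^4) (F' :: (real^4) \<Rightarrow> ((real^4) \<Rightarrow>\<^sub>L (octo^4))).
       (\<forall>v\<in>Eset D. (F has_derivative blinfun_apply (F' v)) (at v)) \<and>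
       continuous_on (Eset D) F' \<and>
       (\<forall>A\<in>O3. \<forall>v\<in>Eset D. F (A *v v) = mat_act A (F v)) \<and>
       (\<forall>v\<in>Eset D. \<forall>(I, J)\<in>Npairs.
          f (oreal (v$1) + (v$2) *\<^sub>R I + (v$3) *\<^sub>R J + (v$4) *\<^sub>R (I \<odot> J)) =
          F v $ 1 + I \<odot> (F v $ 2) + J \<odot> (F v $ 3) + (I \<odot> J) \<odot> (F v $ 4)) \<and>
       (\<forall>v\<in>Eset D.
          pd (F' v) 0 0 - pd (F' v) 1 1 - pd (F' v) 2 2 - pd (F' v) 3 3 = 0 \<and>
          pd (F' v) 1 0 + pd (F' v) 0 1 - pd (F' v) 3 2 + pd (F' v) 2 3 = 0 \<and>
          pd (F' v) 2 0 + pd (F' v) 3 1 + pd (F' v) 0 2 - pd (F' v) 1 3 = 0 \<and>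
          pd (F' v) 3 0 - pd (F' v) 2 1 + pd (F' v) 1 2 + pd (F' v) 0 3 = 0))"

end

theory Submission
  imports Defs "HOL-Complex_Analysis.Conformal_Mappings"
begin

text \<open>
  On a complex half plane \<open>z = x0 + i r\<close> the stem \<open>(u, w)\<close> of \<open>f\<close> solves
  \<open>r u_0 = r w_r + 2 w\<close>, \<open>u_r = - w_0\<close>. With a local potential \<open>Z\<close>, \<open>Z_0 = - u\<close>, \<open>Z_r = w\<close>,
  each real component makes \<open>G = r u + i (r w + Z)\<close> holomorphic, so \<open>r (u - M)\<close> is harmonic in
  the plane. At a local maximum \<open>p = x0 + r I\<close> of \<open>|f|\<close> with \<open>r > 0\<close>, put \<open>c = f(p)\<close> and
  \<open>b = <I w, c>\<close>: the function \<open>r (<u + I w, c> - |c|^2)\<close> has a maximum at \<open>p\<close> but Laplacian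
  \<open>2 b / r\<close>, while maximality on the sphere through \<open>p\<close> gives \<open>b >= |w|^2\<close>; hence \<open>w = 0\<close>
  at \<open>p\<close>. Averaging over \<open>I\<close> and \<open>- I\<close> then makes \<open><u, c>\<close> maximal at \<open>p\<close>, and the maximum
  principle (on the real axis, a Hopf-type version) gives \<open>u = c\<close>, \<open>w = 0\<close> near \<open>p\<close>. This
  propagates by unique continuation for \<open>G\<close>.
\<close>

section \<open>Octonions\<close>

lemma omul_add_right: "x \<odot> (y + z) = x \<odot> y + x \<odot> z"
  and omul_add_left: "(x + y) \<odot> z = x \<odot> z + y \<odot> z"
  and omul_scaleR_right: "x \<odot> (r *\<^sub>R y) = r *\<^sub>R (x \<odot> y)"
  and omul_scaleR_left: "(r *\<^sub>R x) \<odot> y = r *\<^sub>R (x \<odot> y)"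
  by (simp_all add: omul_def qmul_def qcnj_def prod_eq_iff vec_eq_iff forall_3 cross3_def
      inner_vec_def sum_3 algebra_simps)

lemma linear_omul: "linear (\<lambda>y. x \<odot> y)"
  by (rule linearI) (simp_all only: omul_add_right omul_scaleR_right)

lemma omul_minus_left: "(- x) \<odot> y = - (x \<odot> y)"
  using omul_scaleR_left[of "-1"] by simp

lemma omul_zero_right: "x \<odot> 0 = 0"
  using omul_scaleR_right[of x 0] by simp

section \<open>Imaginary units and left multiplication by them\<close>

lemma imag_units_iff: "I \<in> imag_units \<longleftrightarrow> fst (fst I) = 0 \<and> norm I = 1"
proof -
  obtain a p b q where I: "I = ((a, p), (b, q))" by (metis prod.exhaust)
  have "norm I = 1 \<longleftrightarrow> a\<^sup>2 + p \<bullet> p + b\<^sup>2 + q \<bullet> q = 1"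
    by (simp add: I norm_Pair power2_norm_eq_inner algebra_simps)
  moreover have "I \<odot> I = ((a\<^sup>2 - p \<bullet> p - b\<^sup>2 - q \<bullet> q, (2 * a) *\<^sub>R p), ((2 * a * b), (2 * a) *\<^sub>R q))"
    by (simp add: I omul_def qmul_def qcnj_def power2_eq_square scaleR_2[symmetric] cross_refl vec_eq_iff)
  \<comment> \<open>A nonzero real part \<open>a\<close> would force \<open>p\<close>,
    \<open>b\<close> and \<open>q\<close> to vanish in \<open>I \<odot> I = - oone\<close>, leaving
    \<open>a\<^sup>2 = -1\<close>.\<close>
  moreover have "a\<^sup>2 \<noteq> -1" using zero_le_power2[of a] by linarith
  ultimately show ?thesis
    by (auto simp: imag_units_def oone_def I)
qed

lemma uminus_imag_unit: "I \<in> imag_units \<Longrightarrow> - I \<in> imag_units"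
  by (auto simp: imag_units_iff)

lemma imag_units_nonempty: "imag_units \<noteq> {}"
proof -
  have "((0, 0), (1, 0)) \<in> imag_units" by (simp add: imag_units_iff norm_Pair)
  then show ?thesis by auto
qed

text \<open>Left alternativity stands in for the missing associativity, and the square of an
  imaginary octonion is minus its squared norm. The check is made in coordinates.\<close>

lemma imaginary_omul_omul:
  assumes "fst (fst I) = 0"
  shows "I \<odot> (I \<odot> x) = - ((norm I)\<^sup>2 *\<^sub>R x)"
proof -
  obtain p b q a' p' b' q' where I: "I = ((0, p), (b, q))" and x: "x = ((a', p'), (b', q'))"
    using assms by (metis prod.exhaust fst_conv)
  have "(norm I)\<^sup>2 = p \<bullet> p + b\<^sup>2 + q \<bullet> q"
    by (simp add: I norm_Pair power2_norm_eq_inner algebra_simps)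
  then show ?thesis
    unfolding I x
    by (simp add: omul_def qmul_def qcnj_def vec_eq_iff forall_3 cross3_def
        inner_vec_def sum_3 power2_eq_square algebra_simps)
qed

text \<open>Skew-adjointness, combined with alternativity, makes left multiplication by an imaginary
  unit an isometry.\<close>

lemma imaginary_omul_adjoint:
  assumes "fst (fst I) = 0"
  shows "(I \<odot> x) \<bullet> y = - (x \<bullet> (I \<odot> y))"
proof -
  obtain p b q a' p' b' q' c d e g
    where I: "I = ((0, p), (b, q))" and x: "x = ((a', p'), (b', q'))" and y: "y = ((c, d), (e, g))"
    using assms by (metis prod.exhaust fst_conv)
  show ?thesis
    unfolding I x y
    by (simp add: omul_def qmul_def qcnj_def cross3_def inner_vec_def sum_3 algebra_simps)
qed

lemma imag_unit_omul_omul: "I \<in> imag_units \<Longrightarrow> I \<odot> (I \<odot> x) = - x"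
  by (simp add: imag_units_iff imaginary_omul_omul)

lemma norm_imag_unit_omul:
  assumes "I \<in> imag_units" shows "norm (I \<odot> x) = norm x"
  using assms imaginary_omul_adjoint[of I x "I \<odot> x"] imag_unit_omul_omul[OF assms, of x]
  by (simp add: imag_units_iff norm_eq_sqrt_inner)

text \<open>\<open>oone\<close> and \<open>I\<close> span at most two of the eight dimensions, and
  orthogonality to \<open>oone\<close> means vanishing real part.\<close>

lemma exists_orthogonal_imag_unit:
  assumes "I \<in> imag_units" obtains J where "J \<in> imag_units" "I \<bullet> J = 0"
proof -
  have "dim {oone, I} \<le> card {oone, I}" by (intro dim_le_card') auto
  also have "\<dots> \<le> 2" by (simp add: card_insert_if)
  finally have "dim {oone, I} < DIM(octo)" by simp
  then obtain x where x: "x \<noteq> 0" "\<And>y. y \<in> span {oone, I} \<Longrightarrow> orthogonal x y"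
    using orthogonal_to_subspace_exists by blast
  from x(2)[of oone] x(2)[of I] have "x \<bullet> oone = 0" "x \<bullet> I = 0"
    by (auto simp: orthogonal_def span_base)
  then have "fst (fst x) = 0" "I \<bullet> x = 0"
    by (simp add: oone_def inner_prod_def, simp add: inner_commute)
  then have "(1 / norm x) *\<^sub>R x \<in> imag_units" "I \<bullet> ((1 / norm x) *\<^sub>R x) = 0"
    using x(1) by (auto simp: imag_units_iff)
  then show ?thesis using that by blast
qed

lemma cos_sin_imag_unit:
  assumes "I \<in> imag_units" "J \<in> imag_units" "I \<bullet> J = 0"
  shows "cos t *\<^sub>R I + sin t *\<^sub>R J \<in> imag_units"
proof -
  have "(norm (cos t *\<^sub>R I + sin t *\<^sub>R J))\<^sup>2 = 1"
    using assms by (simp add: imag_units_iff power2_norm_eq_inner inner_add_left inner_add_right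
        inner_commute norm_eq_1 flip: power2_eq_square)
  then show ?thesis using assms by (auto simp: imag_units_iff power2_eq_1_iff)
      (metis norm_ge_zero neg_0_le_iff_le not_one_le_zero)
qed

lemma oreal_add_imag_eqD:
  assumes "oreal x0 + x1 *\<^sub>R I = oreal y0 + y1 *\<^sub>R J" "I \<in> imag_units" "J \<in> imag_units"
  shows "x0 = y0" "\<bar>x1\<bar> = \<bar>y1\<bar>"
proof -
  have "fst (fst (oreal x0 + x1 *\<^sub>R I)) = x0" "fst (fst (oreal y0 + y1 *\<^sub>R J)) = y0"
    using assms(2,3) by (auto simp: oreal_def oone_def imag_units_iff)
  then show "x0 = y0" using assms by simp
  with assms(1) have "x1 *\<^sub>R I = y1 *\<^sub>R J" by simp
  then have "norm (x1 *\<^sub>R I) = norm (y1 *\<^sub>R J)" by simp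
  then show "\<bar>x1\<bar> = \<bar>y1\<bar>" using assms by (simp add: imag_units_iff)
qed

section \<open>Axially symmetric systems in the plane\<close>

lemma second_derivative_nonpos_at_max:
  fixes g g' :: "real \<Rightarrow> real"
  assumes "\<forall>\<^sub>F t in nhds 0. (g has_real_derivative g' t) (at t)"
    and "(g' has_real_derivative d) (at 0)"
    and "\<forall>\<^sub>F t in nhds 0. g t \<le> g 0"
  shows "d \<le> 0"
proof (rule ccontr)
  assume "\<not> d \<le> 0"
  then obtain s where s: "s > 0" "\<And>h. h > 0 \<Longrightarrow> h < s \<Longrightarrow> g' 0 < g' h"
    using DERIV_pos_inc_right[OF assms(2)] by auto
  from eventually_conj[OF assms(1,3)] obtain e where e: "e > 0"
    "\<And>t. \<bar>t\<bar> < e \<Longrightarrow> (g has_real_derivative g' t) (at t) \<and> g t \<le> g 0"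
    unfolding eventually_nhds_metric by (auto simp: dist_real_def)
  have "g' 0 = 0"
    by (rule DERIV_local_max[of g "g' 0" 0 e]) (use e in auto)
  define t where "t = min s e / 2"
  have t: "0 < t" "t < s" "t < e" using s e by (auto simp: t_def min_def)
  have "g 0 < g t"
  proof (rule DERIV_pos_imp_increasing_open[OF t(1)])
    show "\<exists>y. (g has_real_derivative y) (at x) \<and> 0 < y" if "0 < x" "x < t" for x
      using that e(2)[of x] s(2)[of x] t \<open>g' 0 = 0\<close> by auto
    show "continuous_on {0..t} g"
      by (rule DERIV_continuous_on[where D=g'], rule has_field_derivative_at_within) (use e(2) t in auto)
  qed
  with e(2)[of t] t show False by auto
qed

text \<open>Closedness of the form \<open>p dx + q dy\<close> is encoded by the shared coefficient
  \<open>p1\<close>; the primitive is the integral of the form along the segment from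
  \<open>z0\<close>.\<close>

lemma closed_form_primitive:
  fixes p q :: "complex \<Rightarrow> real"
  assumes dp: "\<And>z. z \<in> ball z0 R \<Longrightarrow> (p has_derivative (\<lambda>h. Re h * p0 z + Im h * p1 z)) (at z)"
    and dq: "\<And>z. z \<in> ball z0 R \<Longrightarrow> (q has_derivative (\<lambda>h. Re h * p1 z + Im h * q1 z)) (at z)"
    and cont: "continuous_on (ball z0 R) p0" "continuous_on (ball z0 R) p1" "continuous_on (ball z0 R) q1"
  obtains Z where "\<And>z. z \<in> ball z0 R \<Longrightarrow> (Z has_derivative (\<lambda>h. Re h * p z + Im h * q z)) (at z)"
proof -
  define c where "c = (\<lambda>x t. z0 + t *\<^sub>R (x - z0))"
  define BRe BIm where "BRe = Blinfun Re" and "BIm = Blinfun Im"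
  have B: "blinfun_apply BRe h = Re h" "blinfun_apply BIm h = Im h" for h
    by (simp_all add: BRe_def BIm_def bounded_linear_Blinfun_apply bounded_linear_Re bounded_linear_Im)
  \<comment> \<open>By closedness \<open>A1 x t\<close> is both the partial derivative of
    \<open>f x t\<close> in \<open>Re x\<close> and the \<open>t\<close>-derivative of
    \<open>t * p (c x t)\<close>; likewise \<open>A2\<close> with \<open>Im x\<close> and
    \<open>q\<close>. So differentiation under the integral returns \<open>p\<close> and
    \<open>q\<close>.\<close>
  define A1 where "A1 = (\<lambda>x t. p (c x t) + t * (Re (x - z0) * p0 (c x t) + Im (x - z0) * p1 (c x t)))"
  define A2 where "A2 = (\<lambda>x t. q (c x t) + t * (Re (x - z0) * p1 (c x t) + Im (x - z0) * q1 (c x t)))"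
  define fx where "fx = (\<lambda>x t. A1 x t *\<^sub>R BRe + A2 x t *\<^sub>R BIm)"
  define f where "f = (\<lambda>x t. Re (x - z0) * p (c x t) + Im (x - z0) * q (c x t))"
  have cin: "c x t \<in> ball z0 R" if "x \<in> ball z0 R" "t \<in> {0..1}" for x t
  proof -
    have "norm (t *\<^sub>R (x - z0)) \<le> norm (x - z0)"
      using that by (simp add: mult_left_le_one_le)
    also have "\<dots> < R" using that by (simp add: dist_norm norm_minus_commute)
    finally show ?thesis by (simp add: c_def dist_norm)
  qed
  have pq: "continuous_on (ball z0 R) p" "continuous_on (ball z0 R) q"
    using dp dq by (meson continuous_at_imp_continuous_on has_derivative_continuous)+
  have cc: "continuous_on (ball z0 R \<times> {0..1}) (\<lambda>y. g (c (fst y) (snd y)))"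
    if "continuous_on (ball z0 R) g" for g :: "complex \<Rightarrow> real"
    by (rule continuous_on_compose2[OF that]) (auto simp: c_def intro!: continuous_intros cin[unfolded c_def])
  have cc1: "continuous_on {0..1} (\<lambda>t. g (c x t))"
    if "continuous_on (ball z0 R) g" "x \<in> ball z0 R" for g :: "complex \<Rightarrow> real" and x
    by (rule continuous_on_compose2[OF that(1)]) (use cin[OF that(2)] in \<open>auto simp: c_def intro!: continuous_intros\<close>)
  have int: "integral {0..1} (fx x) = p x *\<^sub>R BRe + q x *\<^sub>R BIm" if x: "x \<in> ball z0 R" for x
  proof -
    have d: "((\<lambda>t. t * g (c x t)) has_real_derivative
         g (c x t) + t * (Re (x - z0) * g0 (c x t) + Im (x - z0) * g1 (c x t))) (at t within {0..1})"
      if t: "t \<in> {0..1}"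
        and dg: "\<And>z. z \<in> ball z0 R \<Longrightarrow> (g has_derivative (\<lambda>h. Re h * g0 z + Im h * g1 z)) (at z)"
      for t and g g0 g1 :: "complex \<Rightarrow> real"
    proof -
      have "(c x has_derivative (\<lambda>s. s *\<^sub>R (x - z0))) (at t within {0..1})"
        unfolding c_def by (auto intro!: derivative_eq_intros)
      from has_derivative_compose[OF this dg[OF cin[OF x t]]]
      have "((\<lambda>t. g (c x t)) has_real_derivative (Re (x - z0) * g0 (c x t) + Im (x - z0) * g1 (c x t))) (at t within {0..1})"
        by (simp add: has_field_derivative_def algebra_simps)
          (auto elim!: has_derivative_eq_rhs simp: fun_eq_iff algebra_simps)
      then show ?thesis by (auto intro!: derivative_eq_intros)
    qed
    have "((\<lambda>t. (t * p (c x t)) *\<^sub>R BRe + (t * q (c x t)) *\<^sub>R BIm) has_vector_derivative fx x t) (at t within {0..1})"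
      if "t \<in> {0..1}" for t
      unfolding fx_def A1_def A2_def
      by (intro has_vector_derivative_add has_vector_derivative_scaleR[OF _ has_vector_derivative_const, simplified] d that dp dq) auto
    from fundamental_theorem_of_calculus[OF _ this]
    have "(fx x has_integral p x *\<^sub>R BRe + q x *\<^sub>R BIm) {0..1}"
      by (simp add: c_def)
    then show ?thesis by (rule integral_unique)
  qed
  have "((\<lambda>x. integral (cbox 0 1) (f x)) has_derivative integral (cbox 0 1) (fx x)) (at x within ball z0 R)"
    if x: "x \<in> ball z0 R" for x
  proof (rule leibniz_rule[OF _ _ _ x convex_ball])
    fix x t assume x: "x \<in> ball z0 R" and "t \<in> cbox (0::real) 1"
    then have t: "t \<in> {0..1}" by simp
    have c: "((\<lambda>x. c x t) has_derivative (\<lambda>h. t *\<^sub>R h)) (at x within ball z0 R)"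
      unfolding c_def by (auto intro!: derivative_eq_intros)
    have "((\<lambda>x. p (c x t)) has_derivative (\<lambda>h. t * (Re h * p0 (c x t) + Im h * p1 (c x t)))) (at x within ball z0 R)"
      "((\<lambda>x. q (c x t)) has_derivative (\<lambda>h. t * (Re h * p1 (c x t) + Im h * q1 (c x t)))) (at x within ball z0 R)"
      using has_derivative_compose[OF c dp[OF cin[OF x t]]] has_derivative_compose[OF c dq[OF cin[OF x t]]]
      by (simp_all add: algebra_simps)
    then show "((\<lambda>x. f x t) has_derivative blinfun_apply (fx x t)) (at x within ball z0 R)"
      unfolding f_def fx_def
      by (auto intro!: derivative_eq_intros simp: fun_eq_iff B A1_def A2_def blinfun.bilinear_simps algebra_simps)
  next
    show "f x integrable_on cbox 0 1" if "x \<in> ball z0 R" for x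
      unfolding f_def by (intro integrable_continuous) (auto intro!: continuous_intros cc1 pq that)
    show "continuous_on (ball z0 R \<times> cbox 0 1) (\<lambda>(x, t). fx x t)"
      unfolding fx_def A1_def A2_def case_prod_unfold box_real
      by (intro continuous_intros cc cont pq)
  qed
  then have "((\<lambda>x. integral (cbox 0 1) (f x)) has_derivative (\<lambda>h. Re h * p x + Im h * q x)) (at x)"
    if "x \<in> ball z0 R" for x
    using that
    by (force simp: int at_within_open[of _ "ball z0 R"] B blinfun.bilinear_simps mult.commute
        intro: has_derivative_eq_rhs)
  then show ?thesis using that by blast
qed

text \<open>The Cauchy-Riemann type system of axially symmetric Fueter-regular functions in four
  dimensions, with \<open>Im z\<close> as radius; the factor 2 counts the suppressed directions.
  Multiplying by \<open>Im z\<close> keeps real points in the domain, where the system then forces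
  \<open>w z = 0\<close>.\<close>

definition axial_system :: "complex set \<Rightarrow> (complex \<Rightarrow> 'a::real_normed_vector) \<Rightarrow> (complex \<Rightarrow> 'a) \<Rightarrow> (complex \<Rightarrow> 'a)
    \<Rightarrow> (complex \<Rightarrow> 'a) \<Rightarrow> (complex \<Rightarrow> 'a) \<Rightarrow> (complex \<Rightarrow> 'a) \<Rightarrow> bool" where
  "axial_system S u u0 u1 w w0 w1 \<longleftrightarrow>
     continuous_on S u0 \<and> continuous_on S u1 \<and> continuous_on S w0 \<and> continuous_on S w1 \<and>
     (\<forall>z\<in>S. (u has_derivative (\<lambda>h. Re h *\<^sub>R u0 z + Im h *\<^sub>R u1 z)) (at z) \<and>
            (w has_derivative (\<lambda>h. Re h *\<^sub>R w0 z + Im h *\<^sub>R w1 z)) (at z) \<and>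
            u1 z = - w0 z \<and> Im z *\<^sub>R u0 z = Im z *\<^sub>R w1 z + 2 *\<^sub>R w z)"

lemma axial_system_subset:
  "axial_system S u u0 u1 w w0 w1 \<Longrightarrow> T \<subseteq> S \<Longrightarrow> axial_system T u u0 u1 w w0 w1"
  unfolding axial_system_def by (auto elim: continuous_on_subset)

text \<open>Passage to real components, on which complex analysis acts. The functionals needed are
  \<open>y \<bullet> c\<close> and \<open>(I \<odot> y) \<bullet> c\<close>.\<close>

lemma axial_system_linear_image:
  assumes "bounded_linear l" "axial_system S u u0 u1 w w0 w1"
  shows "axial_system S (\<lambda>z. l (u z)) (\<lambda>z. l (u0 z)) (\<lambda>z. l (u1 z)) (\<lambda>z. l (w z)) (\<lambda>z. l (w0 z)) (\<lambda>z. l (w1 z))"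
proof -
  interpret bounded_linear l by fact
  have "l (Im z *\<^sub>R u0 z) = l (Im z *\<^sub>R w1 z + 2 *\<^sub>R w z)" if "z \<in> S" for z
    using that assms(2) unfolding axial_system_def by metis
  then have "Im z *\<^sub>R l (u0 z) = Im z *\<^sub>R l (w1 z) + 2 *\<^sub>R l (w z)" if "z \<in> S" for z
    using that by (simp add: add scaleR)
  moreover have "((\<lambda>z. l (g z)) has_derivative (\<lambda>h. Re h *\<^sub>R l a + Im h *\<^sub>R l b)) (at z)"
    if "(g has_derivative (\<lambda>h. Re h *\<^sub>R a + Im h *\<^sub>R b)) (at z)" for g a b z
    using has_derivative[OF that] by (simp add: add scaleR)
  ultimately show ?thesis
    using assms(2) unfolding axial_system_def by (auto simp: continuous_on add scaleR neg[symmetric] simp del: neg)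
qed

text \<open>\<open>u1 = - w0\<close> says that \<open>- u dx + w dy\<close> is closed, which yields
  the potential \<open>Z\<close>; the two equations of the system then become the Cauchy-Riemann
  equations of \<open>G\<close>. The derivative is stated through \<open>u\<close> alone, so that
  \<open>Z\<close> stays hidden.\<close>

lemma axial_system_holomorphic:
  fixes u w :: "complex \<Rightarrow> real"
  assumes "axial_system (ball z0 R) u u0 u1 w w0 w1"
  obtains G where "\<And>z. z \<in> ball z0 R \<Longrightarrow> Re (G z) = Im z * u z"
    "\<And>z. z \<in> ball z0 R \<Longrightarrow> (G has_field_derivative Complex (Im z * u0 z) (- (u z + Im z * u1 z))) (at z)"
proof -
  have cont: "continuous_on (ball z0 R) u0" "continuous_on (ball z0 R) w0" "continuous_on (ball z0 R) w1"
    and du: "\<And>z. z \<in> ball z0 R \<Longrightarrow> (u has_derivative (\<lambda>h. Re h * u0 z + Im h * u1 z)) (at z)"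
    and dw: "\<And>z. z \<in> ball z0 R \<Longrightarrow> (w has_derivative (\<lambda>h. Re h * w0 z + Im h * w1 z)) (at z)"
    and u1: "\<And>z. z \<in> ball z0 R \<Longrightarrow> u1 z = - w0 z"
    and u0: "\<And>z. z \<in> ball z0 R \<Longrightarrow> Im z * u0 z = Im z * w1 z + 2 * w z"
    using assms unfolding axial_system_def real_scaleR_def by blast+
  have "((\<lambda>z. - u z) has_derivative (\<lambda>h. Re h * (- u0 z) + Im h * w0 z)) (at z)" if "z \<in> ball z0 R" for z
    using du[OF that] u1[OF that] by (auto intro!: derivative_eq_intros)
  from closed_form_primitive[OF this dw continuous_on_minus[OF cont(1)] cont(2,3)]
  obtain Z where Z: "\<And>z. z \<in> ball z0 R \<Longrightarrow> (Z has_derivative (\<lambda>h. Re h * - u z + Im h * w z)) (at z)"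
    by blast
  define G where "G = (\<lambda>z. complex_of_real (Im z * u z) + \<i> * complex_of_real (Im z * w z + Z z))"
  show ?thesis
  proof
    show "Re (G z) = Im z * u z" for z by (simp add: G_def)
    fix z assume z: "z \<in> ball z0 R"
    have "(G has_derivative (\<lambda>h. of_real (Im h * u z + Im z * (Re h * u0 z + Im h * u1 z)) +
        \<i> * of_real (Im h * w z + Im z * (Re h * w0 z + Im h * w1 z) + (Re h * - u z + Im h * w z)))) (at z)"
      unfolding G_def by (auto intro!: derivative_eq_intros du dw Z z simp: fun_eq_iff algebra_simps)
    moreover have "Im z * (w1 z * x) + w z * (x * 2) = x * (Im z * u0 z)" for x
      unfolding u0[OF z] by (simp add: algebra_simps)
    ultimately show "(G has_field_derivative Complex (Im z * u0 z) (- (u z + Im z * u1 z))) (at z)"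
      unfolding has_field_derivative_def
      by (auto elim!: has_derivative_eq_rhs simp: fun_eq_iff complex_eq_iff u1[OF z] algebra_simps)
  qed
qed

text \<open>The maximum modulus principle, applied to the exponential of a holomorphic function with
  real part \<open>Im z * (u z - k)\<close>, turns a local maximum into constancy on the entire
  ball.\<close>

lemma axial_system_max_imp_constant:
  fixes u w :: "complex \<Rightarrow> real"
  assumes sys: "axial_system (ball z0 R) u u0 u1 w w0 w1" and x: "x \<in> ball z0 R"
    and max: "\<forall>\<^sub>F z in nhds x. Im z * (u z - k) \<le> Im x * (u x - k)"
    and z: "z \<in> ball z0 R"
  shows "Im z * (u z - k) = Im x * (u x - k)"
proof -
  obtain G where G: "\<And>z. z \<in> ball z0 R \<Longrightarrow> Re (G z) = Im z * u z"
    "\<And>z. z \<in> ball z0 R \<Longrightarrow> (G has_field_derivative Complex (Im z * u0 z) (- (u z + Im z * u1 z))) (at z)"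
    using axial_system_holomorphic[OF sys] by blast
  have "G holomorphic_on ball z0 R"
    using G(2) by (meson holomorphic_onI field_differentiable_at_within field_differentiable_def)
  define g where "g = (\<lambda>z. exp (G z + \<i> * of_real k * z))"
  have g: "norm (g z) = exp (Im z * (u z - k))" if "z \<in> ball z0 R" for z
    using G(1)[OF that] by (simp add: g_def algebra_simps)
  obtain U where U: "open U" "x \<in> U" "\<And>z. z \<in> U \<Longrightarrow> Im z * (u z - k) \<le> Im x * (u x - k)"
    using max by (auto simp: eventually_nhds)
  have "g constant_on ball z0 R"
  proof (rule maximum_modulus_principle)
    show "g holomorphic_on ball z0 R"
      unfolding g_def using \<open>G holomorphic_on _\<close> by (intro holomorphic_intros)
    show "open (U \<inter> ball z0 R)" "x \<in> U \<inter> ball z0 R" "U \<inter> ball z0 R \<subseteq> ball z0 R"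
      using U x by auto
    show "norm (g z) \<le> norm (g x)" if "z \<in> U \<inter> ball z0 R" for z
      using that U x by (simp add: g)
  qed auto
  then have "g z = g x" using x z unfolding constant_on_def by auto
  with g[OF x] g[OF z] show ?thesis by simp
qed

text \<open>A ball centred on the real axis meets both half planes, so \<open>u z \<le> u z0\<close>
  gives no sign to \<open>Im z * (u z - u z0)\<close> and the preceding argument does not apply. A
  second factor \<open>Im z\<close> repairs this.\<close>

lemma axial_system_real_max_imp_constant:
  fixes u w :: "complex \<Rightarrow> real"
  assumes sys: "axial_system (ball z0 R) u u0 u1 w w0 w1" and [simp]: "Im z0 = 0"
    and max: "\<And>z. z \<in> ball z0 R \<Longrightarrow> u z \<le> u z0"
    and z1: "z1 \<in> ball z0 R"
  shows "Im z1 * (u z1 - u z0) = 0"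
proof (cases "z1 = z0")
  case False
  define k where "k = u z0"
  \<comment> \<open>This radius places \<open>z1\<close> on the circle on which \<open>Re K\<close>
    is computed.\<close>
  define \<rho> where "\<rho> = norm (z1 - z0)"
  have \<rho>: "0 < \<rho>" "\<rho> < R" using False z1 by (auto simp: \<rho>_def dist_norm norm_minus_commute)
  obtain G where G: "\<And>z. z \<in> ball z0 R \<Longrightarrow> Re (G z) = Im z * u z"
    "\<And>z. z \<in> ball z0 R \<Longrightarrow> (G has_field_derivative Complex (Im z * u0 z) (- (u z + Im z * u1 z))) (at z)"
    using axial_system_holomorphic[OF sys] by blast
  have z0: "z0 \<in> ball z0 R" using \<rho> by simp
  have holG: "G holomorphic_on ball z0 R"
    using G(2) by (meson holomorphic_onI field_differentiable_at_within field_differentiable_def)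
  define g where "g = (\<lambda>z. G z + \<i> * of_real k * z)"
  \<comment> \<open>The difference quotient of \<open>g\<close>, with its removable singularity
    filled in.\<close>
  define H where "H = (\<lambda>z. if z = z0 then deriv g z0 else (g z - g z0) / (z - z0))"
  txt \<open>On the circle of radius \<open>\<rho>\<close> the factor of \<open>g\<close> in \<open>K\<close> is \<open>Im z / \<rho>\<close>, which turns the one-sided
    bound on \<open>u\<close> into a sign for \<open>Re K\<close>; the maximality at the centre gives \<open>K z0 = 0\<close>.\<close>
  define K where "K = (\<lambda>z. - \<i> / 2 * ((z - z0)\<^sup>2 / of_real \<rho> - of_real \<rho>) * H z)"
  have "g holomorphic_on ball z0 R" unfolding g_def by (intro holomorphic_intros holG)
  then have "H holomorphic_on ball z0 R" unfolding H_def by (intro pole_lemma_open) auto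
  then have holK: "K holomorphic_on ball z0 R" unfolding K_def using \<rho> by (intro holomorphic_intros) auto
  have contK: "continuous_on (cball z0 \<rho>) K"
    using holomorphic_on_imp_continuous_on[OF holK] \<rho> by (auto elim!: continuous_on_subset)
  \<comment> \<open>At the real point \<open>z0\<close> the derivative of \<open>G\<close> is
    \<open>- \<i> * u z0\<close>, cancelled by the shift since \<open>k = u z0\<close>.\<close>
  have "(g has_field_derivative 0) (at z0)"
    unfolding g_def
    by (rule derivative_eq_intros G(2) z0 refl)+ (simp add: complex_eq_iff k_def)
  then have Kz0: "K z0 = 0" by (simp add: K_def H_def DERIV_imp_deriv)
  have ReK: "Re (K z) = (Im z)\<^sup>2 * (u z - k) / \<rho>" if "norm (z - z0) = \<rho>" for z
  proof -
    define \<zeta> where "\<zeta> = z - z0"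
    have \<zeta>: "\<zeta> \<noteq> 0" "norm \<zeta> = \<rho>" "z \<noteq> z0" using that \<rho> by (auto simp: \<zeta>_def)
    have zin: "z \<in> ball z0 R" using that \<rho> by (auto simp: dist_norm norm_minus_commute)
    have sq: "\<zeta> * cnj \<zeta> = of_real \<rho> * of_real \<rho>"
      using \<zeta> complex_norm_square[of \<zeta>] by (simp add: power2_eq_square)
    \<comment> \<open>On the circle \<open>\<rho>\<close> is
      \<open>\<zeta> * cnj \<zeta> / \<rho>\<close>. The factor \<open>\<zeta>\<close> cancels the
      denominator of \<open>H\<close>, and the rest is \<open>2 * \<i> * Im z\<close> because
      \<open>z0\<close> is real.\<close>
    have "\<zeta>\<^sup>2 / of_real \<rho> - of_real \<rho> = (\<zeta> * (\<zeta> - cnj \<zeta>)) / of_real \<rho>"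
      using \<rho> by (simp add: field_simps sq power2_eq_square)
    also have "\<zeta> - cnj \<zeta> = 2 * \<i> * of_real (Im z)"
      by (simp add: \<zeta>_def complex_eq_iff)
    finally have "K z = of_real (Im z / \<rho>) * (g z - g z0)"
      using \<zeta> by (simp add: K_def H_def flip: \<zeta>_def)
    moreover have "Re (g z - g z0) = Im z * (u z - k)"
      using G(1)[OF z0] G(1)[OF zin] by (simp add: g_def algebra_simps)
    ultimately show ?thesis by (simp add: power2_eq_square)
  qed
  have "Re (K z) \<le> 0" if "z \<in> ball z0 \<rho>" for z
  proof (rule maximum_real_frontier[where S="ball z0 \<rho>" and f=K and \<xi>=z])
    show "K holomorphic_on interior (ball z0 \<rho>)" using holK \<rho> by (auto elim!: holomorphic_on_subset)
    show "continuous_on (closure (ball z0 \<rho>)) K" using contK \<rho> by simp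
    show "Re (K z) \<le> 0" if "z \<in> frontier (ball z0 \<rho>)" for z
    proof -
      have "norm (z - z0) = \<rho>" using that \<rho> by (auto simp: dist_norm norm_minus_commute)
      moreover from this have "u z \<le> k"
        using max[of z] \<rho> by (auto simp: dist_norm norm_minus_commute k_def)
      ultimately show ?thesis
        using ReK[of z] \<rho> by (simp add: divide_nonpos_pos mult_nonneg_nonpos)
    qed
  qed (use that in auto)
  \<comment> \<open>\<open>Re K\<close> is nonpositive on the disc and zero at its centre, an
    interior maximum of the modulus of \<open>exp (K z)\<close>.\<close>
  then have "(\<lambda>z. exp (K z)) constant_on ball z0 \<rho>"
    using holomorphic_on_subset[OF holK subset_ball[of \<rho> R z0]] \<rho> Kz0
    by (intro maximum_modulus_principle[where U="ball z0 \<rho>" and \<xi>=z0])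
       (auto intro!: holomorphic_intros)
  then obtain c where c: "\<And>z. z \<in> ball z0 \<rho> \<Longrightarrow> exp (K z) = c" by (auto simp: constant_on_def)
  have "Re (K z) = 0" if "z \<in> ball z0 \<rho>" for z
  proof -
    have "norm (exp (K z)) = norm (exp (K z0))" using that \<rho> c by simp
    then show ?thesis by (simp add: Kz0)
  qed
  moreover have "continuous_on (closure (ball z0 \<rho>)) (\<lambda>z. Re (K z))"
    using contK \<rho> by (auto intro!: continuous_intros)
  moreover have "z1 \<in> closure (ball z0 \<rho>)" using \<rho> by (simp add: \<rho>_def dist_norm norm_minus_commute)
  ultimately have "Re (K z1) = 0" using continuous_constant_on_closure by blast
  with ReK[of z1] \<rho> show ?thesis by (auto simp: \<rho>_def k_def)
qed simp

section \<open>Second-order information at a maximum off the real axis\<close>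

lemma eventually_nhds_line:
  fixes z0 d :: complex
  assumes "eventually P (nhds z0)"
  shows "\<forall>\<^sub>F t in nhds 0. P (z0 + of_real t * d)"
proof -
  have "((\<lambda>t. z0 + of_real t * d) \<longlongrightarrow> z0 + of_real 0 * d) (nhds 0)"
    by (intro tendsto_intros filterlim_ident)
  then show ?thesis using assms by (simp add: filterlim_iff)
qed

lemma has_derivative_along_line:
  fixes f :: "complex \<Rightarrow> real"
  assumes "(f has_derivative (\<lambda>h. Re h * p + Im h * q)) (at (z0 + of_real t * d))"
  shows "((\<lambda>t. f (z0 + of_real t * d)) has_real_derivative Re d * p + Im d * q) (at t)"
proof -
  have "((\<lambda>t. z0 + of_real t * d) has_derivative (\<lambda>s. of_real s * d)) (at t)"
    by (auto intro!: derivative_eq_intros)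
  from has_derivative_compose[OF this assms] show ?thesis
    unfolding has_field_derivative_def
    by (rule has_derivative_eq_rhs) (auto simp: fun_eq_iff algebra_simps)
qed

text \<open>The partial derivatives are only assumed continuous; one more derivative comes for free
  because the displayed function is the derivative of a holomorphic \<open>G\<close>.\<close>

lemma axial_system_second_derivative:
  fixes u w :: "complex \<Rightarrow> real"
  assumes sys: "axial_system (ball z0 R) u u0 u1 w w0 w1" and z: "z \<in> ball z0 R"
  obtains g where "((\<lambda>z. Complex (Im z * u0 z) (- (u z + Im z * u1 z))) has_field_derivative g) (at z)"
proof -
  obtain G where G:
    "\<And>z. z \<in> ball z0 R \<Longrightarrow> (G has_field_derivative Complex (Im z * u0 z) (- (u z + Im z * u1 z))) (at z)"
    using axial_system_holomorphic[OF sys] by blast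
  have "G holomorphic_on ball z0 R"
    using G by (meson holomorphic_onI field_differentiable_at_within field_differentiable_def)
  then have "deriv G holomorphic_on ball z0 R" by (intro holomorphic_deriv) auto
  then have "(deriv G has_field_derivative deriv (deriv G) z) (at z)"
    using z by (intro holomorphic_derivI) auto
  then have "((\<lambda>z. Complex (Im z * u0 z) (- (u z + Im z * u1 z))) has_field_derivative deriv (deriv G) z) (at z)"
    by (rule has_field_derivative_transform_within_open[OF _ open_ball z]) (rule DERIV_imp_deriv[OF G])
  then show ?thesis using that by blast
qed

text \<open>Used with \<open>a\<close>, \<open>b\<close>, \<open>v\<close> the scalar products of
  \<open>u\<close>, \<open>I \<odot> w\<close>, \<open>I \<odot> u\<close> with a fixed vector. At
  the maximum the horizontal and vertical second derivatives of \<open>\<Psi>\<close> are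
  nonpositive; in their sum \<open>g'\<close> and \<open>h'\<close> cancel, leaving
  \<open>v0 z0 - b1 z0\<close>, which is \<open>2 * b z0 / Im z0\<close>.\<close>

lemma axial_system_nonpos_at_max:
  fixes a b v d :: "complex \<Rightarrow> real"
  assumes A: "axial_system (ball z0 R) a a0 a1 d d0 d1"
    and B: "axial_system (ball z0 R) v v0 v1 b b0 b1"
    and "R > 0" and Im: "Im z0 > 0"
    and max: "\<forall>\<^sub>F z in nhds z0. a z + b z \<le> a z0 + b z0"
  shows "b z0 \<le> 0"
proof -
  define M where "M = a z0 + b z0"
  define g where "g = (\<lambda>z. Complex (Im z * a0 z) (- (a z + Im z * a1 z)))"
  define h where "h = (\<lambda>z. Complex (Im z * v0 z) (- (v z + Im z * v1 z)))"
  define \<Psi> where "\<Psi> = (\<lambda>z. Im z * (a z + b z - M))"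
  have z0: "z0 \<in> ball z0 R" using \<open>R > 0\<close> by simp
  obtain g' where g': "(g has_field_derivative g') (at z0)"
    using axial_system_second_derivative[OF A z0] unfolding g_def by blast
  obtain h' where h': "(h has_field_derivative h') (at z0)"
    using axial_system_second_derivative[OF B z0] unfolding h_def by blast
  have da: "\<And>z. z \<in> ball z0 R \<Longrightarrow> (a has_derivative (\<lambda>h. Re h * a0 z + Im h * a1 z)) (at z)"
    using A unfolding axial_system_def real_scaleR_def by blast
  have db: "\<And>z. z \<in> ball z0 R \<Longrightarrow> (b has_derivative (\<lambda>h. Re h * b0 z + Im h * b1 z)) (at z)"
    and dv: "\<And>z. z \<in> ball z0 R \<Longrightarrow> (v has_derivative (\<lambda>h. Re h * v0 z + Im h * v1 z)) (at z)"
    and v1: "\<And>z. z \<in> ball z0 R \<Longrightarrow> v1 z = - b0 z"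
    and v0: "\<And>z. z \<in> ball z0 R \<Longrightarrow> Im z * v0 z = Im z * b1 z + 2 * b z"
    using B unfolding axial_system_def real_scaleR_def by blast+
  \<comment> \<open>Writing the gradient through the holomorphic \<open>g\<close>, \<open>h\<close>
    and the undifferentiated \<open>v\<close>, \<open>b\<close> allows a second differentiation
    without any second derivative of \<open>a\<close> or \<open>b\<close>.\<close>
  have d\<Psi>: "(\<Psi> has_derivative (\<lambda>k. Re k * (Re (g z) + v z + Im (h z)) + Im k * (- Im (g z) - M + Re (h z) - b z))) (at z)"
    if z: "z \<in> ball z0 R" for z
  proof -
    have "(\<Psi> has_derivative (\<lambda>k. Im k * (a z + b z - M) + Im z * ((Re k * a0 z + Im k * a1 z) + (Re k * b0 z + Im k * b1 z)))) (at z)"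
      unfolding \<Psi>_def by (auto intro!: derivative_eq_intros da[OF z] db[OF z])
    moreover have "Re (g z) + v z + Im (h z) = Im z * a0 z + Im z * b0 z"
      by (simp add: g_def h_def v1[OF z])
    moreover have "- Im (g z) - M + Re (h z) - b z = a z + b z - M + Im z * a1 z + Im z * b1 z"
      by (simp add: g_def h_def v0[OF z])
    ultimately show ?thesis
      by (auto elim!: has_derivative_eq_rhs simp: fun_eq_iff algebra_simps)
  qed
  have ball: "\<forall>\<^sub>F z in nhds z0. z \<in> ball z0 R"
    using z0 by (intro eventually_nhds_in_open) auto
  have "\<forall>\<^sub>F z in nhds z0. Im z > 0"
    using eventually_nhds_in_open[of "{z. Im z > 0}" z0] Im by (simp add: open_halfspace_Im_gt)
  with max have "\<forall>\<^sub>F z in nhds z0. \<Psi> z \<le> \<Psi> z0"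
    by eventually_elim (auto simp: \<Psi>_def M_def intro: mult_nonneg_nonpos)
  note max\<Psi> = eventually_nhds_line[OF this]
  have dRe: "((\<lambda>z. Re (f z)) has_derivative (\<lambda>k. Re k * Re f' + Im k * (- Im f'))) (at z)"
    and dIm: "((\<lambda>z. Im (f z)) has_derivative (\<lambda>k. Re k * Im f' + Im k * Re f')) (at z)"
    if "(f has_field_derivative f') (at z)" for f f' z
    using has_derivative_Re[OF that[unfolded has_field_derivative_def]]
      has_derivative_Im[OF that[unfolded has_field_derivative_def]]
    by (simp_all add: algebra_simps)
  have hor: "((\<lambda>z. Re (g z) + v z + Im (h z)) has_derivative
      (\<lambda>k. Re k * (Re g' + v0 z0 + Im h') + Im k * (- Im g' + v1 z0 + Re h'))) (at z0)"
    by (rule has_derivative_eq_rhs[OF has_derivative_add[OF has_derivative_add[OF dRe[OF g'] dv[OF z0]] dIm[OF h']]])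
      (simp add: fun_eq_iff algebra_simps)
  have ver: "((\<lambda>z. - Im (g z) - M + Re (h z) - b z) has_derivative
      (\<lambda>k. Re k * (- Im g' + Re h' - b0 z0) + Im k * (- Re g' - Im h' - b1 z0))) (at z0)"
    by (rule has_derivative_eq_rhs[OF has_derivative_diff[OF has_derivative_add[OF has_derivative_diff[OF
          has_derivative_minus[OF dIm[OF g']] has_derivative_const] dRe[OF h']] db[OF z0]]])
      (simp add: fun_eq_iff algebra_simps)
  have "Re g' + v0 z0 + Im h' \<le> 0"
  proof (rule second_derivative_nonpos_at_max)
    let ?l = "\<lambda>t. z0 + of_real t * 1"
    show "\<forall>\<^sub>F t in nhds 0. ((\<lambda>t. \<Psi> (?l t)) has_real_derivative Re (g (?l t)) + v (?l t) + Im (h (?l t))) (at t)"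
      using eventually_nhds_line[OF ball, of 1]
      by eventually_elim (use has_derivative_along_line[OF d\<Psi>, of _ _ 1] in simp)
    show "((\<lambda>t. Re (g (?l t)) + v (?l t) + Im (h (?l t))) has_real_derivative Re g' + v0 z0 + Im h') (at 0)"
      using has_derivative_along_line[of _ _ _ z0 0 1, simplified, OF hor[simplified]] by simp
    show "\<forall>\<^sub>F t in nhds 0. \<Psi> (?l t) \<le> \<Psi> (?l 0)"
      using max\<Psi>[of 1] by simp
  qed
  moreover have "- Re g' - Im h' - b1 z0 \<le> 0"
  proof (rule second_derivative_nonpos_at_max)
    let ?l = "\<lambda>t. z0 + of_real t * \<i>"
    show "\<forall>\<^sub>F t in nhds 0. ((\<lambda>t. \<Psi> (?l t)) has_real_derivative
        - Im (g (?l t)) - M + Re (h (?l t)) - b (?l t)) (at t)"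
      using eventually_nhds_line[OF ball, of \<i>]
      by eventually_elim (use has_derivative_along_line[OF d\<Psi>, of _ _ \<i>] in simp)
    show "((\<lambda>t. - Im (g (?l t)) - M + Re (h (?l t)) - b (?l t)) has_real_derivative - Re g' - Im h' - b1 z0) (at 0)"
      using has_derivative_along_line[of _ _ _ z0 0 \<i>, simplified, OF ver[simplified]] by simp
    show "\<forall>\<^sub>F t in nhds 0. \<Psi> (?l t) \<le> \<Psi> (?l 0)"
      using max\<Psi>[of \<i>] by simp
  qed
  ultimately have "v0 z0 \<le> b1 z0" by simp
  then have "Im z0 * v0 z0 \<le> Im z0 * b1 z0" using Im by simp
  then show ?thesis using v0[OF z0] by simp
qed

text \<open>The premise leaves out real points because local constancy at a maximum is first
  obtained off the axis.\<close>

lemma axial_system_continuation: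
  fixes u w :: "complex \<Rightarrow> real"
  assumes sys: "axial_system (ball z0 R) u u0 u1 w w0 w1" and x: "x \<in> ball z0 R"
    and near: "\<forall>\<^sub>F z in nhds x. Im z \<noteq> 0 \<longrightarrow> u z = k \<and> w z = 0"
    and z: "z \<in> ball z0 R"
  shows "u z = k \<and> w z = 0"
proof -
  have du: "\<And>z. z \<in> ball z0 R \<Longrightarrow> (u has_derivative (\<lambda>h. Re h * u0 z + Im h * u1 z)) (at z)"
    and dw: "\<And>z. z \<in> ball z0 R \<Longrightarrow> (w has_derivative (\<lambda>h. Re h * w0 z + Im h * w1 z)) (at z)"
    and u1: "\<And>z. z \<in> ball z0 R \<Longrightarrow> u1 z = - w0 z"
    and u0: "\<And>z. z \<in> ball z0 R \<Longrightarrow> Im z * u0 z = Im z * w1 z + 2 * w z"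
    using sys unfolding axial_system_def real_scaleR_def by blast+
  have "\<forall>\<^sub>F z in nhds x. Im z * (u z - k) = 0"
    using near by eventually_elim auto
  moreover from this have "Im x * (u x - k) = 0" by (rule eventually_nhds_x_imp_x)
  ultimately have "\<forall>\<^sub>F z in nhds x. Im z * (u z - k) \<le> Im x * (u x - k)" and "Im x * (u x - k) = 0"
    by (auto elim: eventually_mono simp del: mult_eq_0_iff)
  \<comment> \<open>A function vanishing near \<open>x\<close> has a local maximum there, so the
    maximum principle serves as unique continuation.\<close>
  then have off: "u y = k" if "y \<in> ball z0 R" "Im y \<noteq> 0" for y
    using axial_system_max_imp_constant[OF sys x _ that(1), of k] that by auto
  have u: "u y = k" if y: "y \<in> ball z0 R" for y
  proof (cases "Im y = 0")
    case True
    have "((\<lambda>t. y + of_real t * \<i>) \<longlongrightarrow> y + of_real 0 * \<i>) (at 0)" by (intro tendsto_intros)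
    then have "((\<lambda>t. u (y + of_real t * \<i>)) \<longlongrightarrow> u y) (at 0)"
      by (intro isCont_tendsto_compose[of y u] has_derivative_continuous[OF du[OF y]]) simp_all
    moreover have "\<forall>\<^sub>F t in at 0. y + of_real t * \<i> \<in> ball z0 R"
      using eventually_nhds_line[OF eventually_nhds_in_open[OF open_ball y], of \<i>]
      by (simp add: eventually_at_filter eventually_mono)
    then have "\<forall>\<^sub>F t in at 0. u (y + of_real t * \<i>) = k"
      using eventually_neq_at_within[of 0 0 UNIV] by eventually_elim (simp add: off True)
    then have "((\<lambda>t. u (y + of_real t * \<i>)) \<longlongrightarrow> k) (at 0)" by (rule tendsto_eventually)
    ultimately show ?thesis by (intro tendsto_unique[of "at (0::real)"]) auto
  qed (use off y in auto)
  have 0: "u0 y = 0" "u1 y = 0" if y: "y \<in> ball z0 R" for y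
  proof -
    have "(u has_derivative (\<lambda>_. 0)) (at y)"
      by (rule has_derivative_transform_within_open[of "\<lambda>_. k", OF _ open_ball y]) (auto simp: u)
    from has_derivative_unique[OF this du[OF y]]
    have "0 = Re h * u0 y + Im h * u1 y" for h by metis
    from this[of 1] this[of \<i>] show "u0 y = 0" "u1 y = 0" by auto
  qed
  \<comment> \<open>For constant \<open>u\<close> the system reads \<open>w0 = 0\<close> and
    \<open>Im z * w1 + 2 * w = 0\<close>, with integrating factor \<open>Im z\<close>
    squared.\<close>
  have "((\<lambda>z. (Im z)\<^sup>2 * w z) has_derivative (\<lambda>_. 0)) (at y within ball z0 R)" if y: "y \<in> ball z0 R" for y
  proof -
    have "w0 y = 0" using 0[OF y] u1[OF y] by simp
    moreover have "Im y * w1 y + 2 * w y = 0" using u0[OF y] 0[OF y] by simp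
    then have "Im y * (h * (Im y * w1 y + 2 * w y)) = 0" for h by simp
    then have "(Im y)\<^sup>2 * (h * w1 y) + 2 * h * Im y * w y = 0" for h
      by (simp add: power2_eq_square algebra_simps)
    ultimately show ?thesis
      by (auto intro!: derivative_eq_intros has_derivative_at_withinI[OF dw[OF y]] simp: fun_eq_iff)
  qed
  then have "\<exists>c. \<forall>y\<in>ball z0 R. (Im y)\<^sup>2 * w y = c"
    by (rule has_derivative_zero_constant[OF convex_ball])
  then obtain c where c: "\<And>y. y \<in> ball z0 R \<Longrightarrow> (Im y)\<^sup>2 * w y = c" by blast
  have "(Im x)\<^sup>2 * w x = 0" using eventually_nhds_x_imp_x[OF near] by (cases "Im x = 0") simp_all
  with c[OF x] have "c = 0" by simp
  then have "w z = 0" using c[OF z] u0[OF z] by (cases "Im z = 0") simp_all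
  with u[OF z] show ?thesis by simp
qed

section \<open>Stems of slice Fueter-regular functions\<close>

definition half_plane_embed :: "complex \<Rightarrow> real^4" where
  "half_plane_embed z = Re z *\<^sub>R axis 1 1 + Im z *\<^sub>R axis 2 1"

definition coord_reflection :: "4 \<Rightarrow> real^4^4" where
  "coord_reflection k = (\<chi> i j. if i = j then if i = k then -1 else 1 else 0)"

definition plane_rotation :: "4 \<Rightarrow> real \<Rightarrow> real^4^4" where
  "plane_rotation k t = (\<chi> i j.
     if i = 2 then (if j = 2 then cos t else if j = k then - sin t else 0)
     else if i = k then (if j = 2 then sin t else if j = k then cos t else 0)
     else if i = j then 1 else 0)"

lemma half_plane_embed_nth [simp]:
  "half_plane_embed z $ 1 = Re z" "half_plane_embed z $ 2 = Im z"
  "half_plane_embed z $ 3 = 0" "half_plane_embed z $ 4 = 0"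
  by (simp_all add: half_plane_embed_def axis_def)

lemma bounded_linear_half_plane_embed: "bounded_linear half_plane_embed"
  unfolding half_plane_embed_def
  by (intro bounded_linear_add bounded_linear_compose[OF bounded_linear_scaleR_left]
      bounded_linear_Re bounded_linear_Im)

lemma plane_rotation_in_O3:
  assumes "k = 3 \<or> k = 4" shows "plane_rotation k t \<in> O3"
proof -
  note defs = O3_def orthogonal_matrix vec_eq_iff forall_4 matrix_matrix_mult_def sum_4 transpose_def
      mat_def plane_rotation_def matrix_vector_mult_def axis_def
  have "plane_rotation 3 t \<in> O3" "plane_rotation 4 t \<in> O3"
    using sin_cos_squared_add3[of t] by (simp_all add: defs add.commute)
  then show ?thesis using assms by metis
qed

lemma coord_reflection_in_O3:
  assumes "k \<noteq> 1" shows "coord_reflection k \<in> O3"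
proof -
  note defs = O3_def orthogonal_matrix vec_eq_iff forall_4 matrix_matrix_mult_def sum_4 transpose_def
      mat_def coord_reflection_def matrix_vector_mult_def axis_def
  have "coord_reflection 2 \<in> O3" "coord_reflection 3 \<in> O3" "coord_reflection 4 \<in> O3"
    by (simp_all add: defs)
  then show ?thesis using assms exhaust_4[of k] by metis
qed

lemma coord_reflection_mult: "(coord_reflection k *v v) $ i = (if i = k then - v $ i else v $ i)"
proof -
  have "(coord_reflection k *v v) $ i = (\<Sum>j\<in>UNIV. if j = i then if i = k then - v $ i else v $ i else 0)"
    unfolding coord_reflection_def matrix_vector_mult_def vec_lambda_beta by (rule sum.cong) simp_all
  then show ?thesis by simp
qed

lemma coord_reflection_act: "mat_act (coord_reflection k) w $ i = (if i = k then - w $ i else w $ i)"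
proof -
  have "mat_act (coord_reflection k) w $ i = (\<Sum>j\<in>UNIV. if j = i then if i = k then - w $ i else w $ i else 0)"
    unfolding mat_act_def coord_reflection_def vec_lambda_beta by (rule sum.cong) simp_all
  then show ?thesis by simp
qed

text \<open>The reflection in coordinate \<open>k\<close> fixes \<open>v\<close> but negates
  component \<open>k\<close> of \<open>F v\<close>.\<close>

lemma O3_equivariant_zero:
  fixes F :: "real^4 \<Rightarrow> octo^4"
  assumes "\<forall>A\<in>O3. \<forall>v\<in>S. F (A *v v) = mat_act A (F v)" "v \<in> S" "v $ k = 0" "k \<noteq> 1"
  shows "F v $ k = 0"
proof -
  have "coord_reflection k *v v = v"
    using assms(3) by (auto simp: vec_eq_iff coord_reflection_mult)
  then have "F v = mat_act (coord_reflection k) (F v)"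
    using assms coord_reflection_in_O3 by metis
  then have "F v $ k = - F v $ k"
    by (metis coord_reflection_act)
  then show ?thesis by (simp add: eq_neg_iff_add_eq_0 flip: scaleR_2)
qed

lemma open_Eset:
  assumes "open D" shows "open (Eset D)"
proof -
  have "Eset D = (\<lambda>v. (v$1, sqrt ((v$2)^2 + (v$3)^2 + (v$4)^2))) -` D"
    by (auto simp: Eset_def)
  then show ?thesis
    using assms by (auto intro!: open_vimage continuous_intros)
qed

text \<open>\<open>u\<close> and \<open>w\<close> are the first two components of \<open>F\<close>
  along the embedded plane. The other two vanish on it, but their derivatives across it do not:
  rotations express these through \<open>w\<close>, which produces the term
  \<open>2 *\<^sub>R w\<close>.\<close>

lemma slice_fueter_regular_imp_axial_system:
  assumes "open D" and sym: "\<forall>x0 x1. (x0, x1) \<in> D \<longrightarrow> (x0, - x1) \<in> D"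
    and "slice_fueter_regular D f"
  obtains u u0 u1 w w0 w1 where "axial_system {z. (Re z, Im z) \<in> D} u u0 u1 w w0 w1"
    "\<And>z. (Re z, Im z) \<in> D \<Longrightarrow> u (cnj z) = u z \<and> w (cnj z) = - w z"
    "\<And>z I. (Re z, Im z) \<in> D \<Longrightarrow> I \<in> imag_units \<Longrightarrow> f (oreal (Re z) + Im z *\<^sub>R I) = u z + I \<odot> w z"
proof -
  obtain F :: "real^4 \<Rightarrow> octo^4" and F' :: "(real^4) \<Rightarrow> ((real^4) \<Rightarrow>\<^sub>L (octo^4))" where
    dF: "\<And>v. v \<in> Eset D \<Longrightarrow> (F has_derivative blinfun_apply (F' v)) (at v)"
    and contF': "continuous_on (Eset D) F'"
    and equiv: "\<forall>A\<in>O3. \<forall>v\<in>Eset D. F (A *v v) = mat_act A (F v)"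
    and fF: "\<And>v I J. v \<in> Eset D \<Longrightarrow> (I, J) \<in> Npairs \<Longrightarrow>
          f (oreal (v$1) + (v$2) *\<^sub>R I + (v$3) *\<^sub>R J + (v$4) *\<^sub>R (I \<odot> J)) =
          F v $ 1 + I \<odot> (F v $ 2) + J \<odot> (F v $ 3) + (I \<odot> J) \<odot> (F v $ 4)"
    and CR1: "\<And>v. v \<in> Eset D \<Longrightarrow> pd (F' v) 0 0 - pd (F' v) 1 1 - pd (F' v) 2 2 - pd (F' v) 3 3 = 0"
    and CR2: "\<And>v. v \<in> Eset D \<Longrightarrow> pd (F' v) 1 0 + pd (F' v) 0 1 - pd (F' v) 3 2 + pd (F' v) 2 3 = 0"
    using assms(3) unfolding slice_fueter_regular_def by (fastforce simp only: prod.case)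
  define S where "S = {z. (Re z, Im z) \<in> D}"
  let ?e = half_plane_embed
  interpret e: bounded_linear ?e by (rule bounded_linear_half_plane_embed)
  \<comment> \<open>\<open>Eset\<close> sees the radius \<open>\<bar>Im z\<bar>\<close>, so negative
    \<open>Im z\<close> calls on the symmetry of \<open>D\<close>.\<close>
  have eE: "?e z \<in> Eset D" if "z \<in> S" for z
  proof -
    have "(Re z, \<bar>Im z\<bar>) \<in> D" using that sym by (auto simp: S_def abs_if)
    then show ?thesis by (simp add: Eset_def)
  qed
  have oE: "open (Eset D)" by (rule open_Eset) fact
  have part: "((\<lambda>t. F (c t) $ k) has_derivative (\<lambda>s. F' (c x) (c' s) $ k)) (at x)"
    if "(c has_derivative c') (at x)" "c x \<in> Eset D" for c c' k and x :: "'b::real_normed_vector"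
    using has_derivative_compose[OF that(1) dF[OF that(2)]]
    by (rule bounded_linear.has_derivative[OF bounded_linear_vec_nth])
  \<comment> \<open>Rotating the base point by \<open>t\<close> turns component \<open>k\<close> of
    \<open>F\<close> into \<open>sin t\<close> times its second component; compare derivatives at
    \<open>t = 0\<close>.\<close>
  have diag: "Im z *\<^sub>R (F' (?e z) (axis k 1) $ k) = F (?e z) $ 2" if z: "z \<in> S" and k: "k = 3 \<or> k = 4" for z k
  proof -
    define c where "c = (\<lambda>t. Re z *\<^sub>R axis 1 1 + (Im z * cos t) *\<^sub>R axis 2 1 + (Im z * sin t) *\<^sub>R axis k 1 :: real^4)"
    have c: "plane_rotation k t *v ?e z = c t" for t
      using k by (elim disjE) (simp_all add: c_def vec_eq_iff forall_4 plane_rotation_def matrix_vector_mult_def sum_4 axis_def)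
    have "F (?e z) $ 3 = 0" "F (?e z) $ 4 = 0"
      by (rule O3_equivariant_zero[OF equiv eE[OF z]]; simp)+
    then have Fc: "F (c t) $ k = sin t *\<^sub>R F (?e z) $ 2" for t
      using bspec[OF bspec[OF equiv plane_rotation_in_O3[OF k, of t]] eE[OF z]] k unfolding c
      by (elim disjE) (simp_all add: mat_act_def sum_4 plane_rotation_def)
    have c0: "c 0 = ?e z" by (simp add: c_def half_plane_embed_def)
    have "(c has_derivative (\<lambda>s. (s * Im z) *\<^sub>R axis k 1)) (at 0)"
      unfolding c_def by (auto intro!: derivative_eq_intros simp: algebra_simps)
    from part[OF this, of k] eE[OF z]
    have "((\<lambda>t. sin t *\<^sub>R F (?e z) $ 2) has_derivative (\<lambda>s. F' (?e z) ((s * Im z) *\<^sub>R axis k 1) $ k)) (at 0)"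
      by (simp add: Fc c0)
    moreover have "((\<lambda>t. sin t *\<^sub>R F (?e z) $ 2) has_derivative (\<lambda>s. s *\<^sub>R F (?e z) $ 2)) (at 0)"
      by (auto intro!: derivative_eq_intros)
    ultimately have "(\<lambda>s. F' (?e z) ((s * Im z) *\<^sub>R axis k 1) $ k) = (\<lambda>s. s *\<^sub>R F (?e z) $ 2)"
      by (rule has_derivative_unique)
    from fun_cong[OF this, of 1] show ?thesis by (simp add: blinfun.scaleR_right)
  qed
  \<comment> \<open>Coordinate \<open>j\<close> stays zero along the line in direction
    \<open>k\<close>, hence so does component \<open>j\<close> of \<open>F\<close>.\<close>
  have offdiag: "F' (?e z) (axis k 1) $ j = 0" if z: "z \<in> S" and kj: "j = 3 \<and> k = 4 \<or> j = 4 \<and> k = 3" for z j k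
  proof -
    define c where "c = (\<lambda>t. ?e z + t *\<^sub>R axis k 1)"
    have c0: "c 0 = ?e z" by (simp add: c_def)
    have dc: "(c has_derivative (\<lambda>s. s *\<^sub>R axis k 1)) (at 0)"
      unfolding c_def by (auto intro!: derivative_eq_intros)
    have op: "open (c -` Eset D)" unfolding c_def by (intro open_vimage oE continuous_intros)
    have mem: "0 \<in> c -` Eset D" using eE[OF z] by (simp add: c0)
    have zero: "F (c t) $ j = 0" if "t \<in> c -` Eset D" for t
    proof (rule O3_equivariant_zero[OF equiv])
      show "c t $ j = 0" using kj by (elim disjE conjE) (simp_all add: c_def axis_def)
      show "j \<noteq> 1" using kj by (elim disjE conjE) simp_all
    qed (use that in simp)
    have "((\<lambda>t. F (c t) $ j) has_derivative (\<lambda>s. 0)) (at 0)"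
      by (rule has_derivative_transform_within_open[OF has_derivative_const op mem]) (simp add: zero)
    moreover have "((\<lambda>t. F (c t) $ j) has_derivative (\<lambda>s. F' (?e z) (s *\<^sub>R axis k 1) $ j)) (at 0)"
      using part[OF dc, of j] eE[OF z] by (simp add: c0)
    ultimately have "(\<lambda>s. 0) = (\<lambda>s. F' (?e z) (s *\<^sub>R axis k 1) $ j)"
      by (rule has_derivative_unique)
    from fun_cong[OF this, of 1] show ?thesis by simp
  qed
  have cont: "continuous_on S (\<lambda>z. F' (?e z) v $ k)" for v k
  proof -
    have "continuous_on S ?e" by (intro linear_continuous_on bounded_linear_half_plane_embed)
    then have "continuous_on S (\<lambda>z. F' (?e z))" using eE
      by (intro continuous_on_compose2[OF contF']) auto
    then show ?thesis by (intro continuous_intros)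
  qed
  have dstem: "((\<lambda>z. F (?e z) $ k) has_derivative
      (\<lambda>h. Re h *\<^sub>R F' (?e z) (axis 1 1) $ k + Im h *\<^sub>R F' (?e z) (axis 2 1) $ k)) (at z)"
    if z: "z \<in> S" for z k
    using part[OF e.has_derivative[OF has_derivative_ident] eE[OF z], of k]
    by (simp add: half_plane_embed_def blinfun.add_right blinfun.scaleR_right)
  have sys: "axial_system S
     (\<lambda>z. F (?e z) $ 1) (\<lambda>z. F' (?e z) (axis 1 1) $ 1) (\<lambda>z. F' (?e z) (axis 2 1) $ 1)
     (\<lambda>z. F (?e z) $ 2) (\<lambda>z. F' (?e z) (axis 1 1) $ 2) (\<lambda>z. F' (?e z) (axis 2 1) $ 2)"
    unfolding axial_system_def
  proof (intro conjI ballI cont dstem)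
    fix z assume z: "z \<in> S"
    show "F' (?e z) (axis 2 1) $ 1 = - F' (?e z) (axis 1 1) $ 2"
      using CR2[OF eE[OF z]] offdiag[OF z, of 3 4] offdiag[OF z, of 4 3]
      by (simp add: pd_def eq_neg_iff_add_eq_0)
    have "F' (?e z) (axis 1 1) $ 1 = F' (?e z) (axis 2 1) $ 2 + F' (?e z) (axis 3 1) $ 3 + F' (?e z) (axis 4 1) $ 4"
      using CR1[OF eE[OF z]] by (simp add: pd_def algebra_simps)
    then show "Im z *\<^sub>R F' (?e z) (axis 1 1) $ 1 = Im z *\<^sub>R F' (?e z) (axis 2 1) $ 2 + 2 *\<^sub>R F (?e z) $ 2"
      using diag[OF z, of 3] diag[OF z, of 4] by (simp add: scaleR_add_right scaleR_2)
  qed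
  show ?thesis
  proof (rule that[OF sys[unfolded S_def]])
    fix z assume z: "(Re z, Im z) \<in> D"
    have "coord_reflection 2 *v ?e z = ?e (cnj z)"
      by (auto simp: vec_eq_iff coord_reflection_mult forall_4)
    then have "F (?e (cnj z)) = mat_act (coord_reflection 2) (F (?e z))"
      using bspec[OF bspec[OF equiv coord_reflection_in_O3[of 2]] eE[of z]] z by (simp add: S_def)
    then show "F (?e (cnj z)) $ 1 = F (?e z) $ 1 \<and> F (?e (cnj z)) $ 2 = - F (?e z) $ 2"
      by (simp add: coord_reflection_act)
    fix I assume I: "I \<in> imag_units"
    obtain J where "J \<in> imag_units" "I \<bullet> J = 0" using exists_orthogonal_imag_unit[OF I] by blast
    then have "(I, J) \<in> Npairs" using I by (simp add: Npairs_def)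
    moreover have z: "z \<in> S" using z by (simp add: S_def)
    moreover have "F (?e z) $ 3 = 0" "F (?e z) $ 4 = 0"
      by (rule O3_equivariant_zero[OF equiv eE[OF z]]; simp)+
    ultimately show "f (oreal (Re z) + Im z *\<^sub>R I) = F (?e z) $ 1 + I \<odot> F (?e z) $ 2"
      using fF[OF eE[OF z], of I J] by (simp add: omul_zero_right)
  qed
qed

section \<open>The maximum principle\<close>

lemma axial_system_continuation_inner:
  fixes u w :: "complex \<Rightarrow> 'a::real_inner"
  assumes sys: "axial_system S u u0 u1 w w0 w1" and "ball z0 R \<subseteq> S" and x: "x \<in> ball z0 R"
    and near: "\<forall>\<^sub>F z in nhds x. Im z \<noteq> 0 \<longrightarrow> u z = c \<and> w z = 0"
    and z: "z \<in> ball z0 R"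
  shows "u z = c \<and> w z = 0"
proof -
  have "u z \<bullet> b = c \<bullet> b \<and> w z \<bullet> b = 0" for b
  proof (rule axial_system_continuation[OF _ x _ z])
    show "axial_system (ball z0 R) (\<lambda>z. u z \<bullet> b) (\<lambda>z. u0 z \<bullet> b) (\<lambda>z. u1 z \<bullet> b)
        (\<lambda>z. w z \<bullet> b) (\<lambda>z. w0 z \<bullet> b) (\<lambda>z. w1 z \<bullet> b)"
      by (intro axial_system_linear_image[OF bounded_linear_inner_left] axial_system_subset[OF sys] assms)
    show "\<forall>\<^sub>F z in nhds x. Im z \<noteq> 0 \<longrightarrow> u z \<bullet> b = c \<bullet> b \<and> w z \<bullet> b = 0"
      using near by eventually_elim auto
  qed
  \<comment> \<open>The point \<open>z\<close> is fixed, so the test vector may depend on it; these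
    two choices give vanishing norms.\<close>
  from this[of "u z - c"] this[of "w z"] show ?thesis
    by (metis eq_iff_diff_eq_0 inner_diff_left inner_eq_zero_iff)
qed

text \<open>By Cauchy-Schwarz the scalar product of \<open>u\<close> with \<open>c = u z0\<close> is
  maximal at \<open>z0\<close>, so the scalar maximum principles make it constant off the axis. The
  bound on the norms then leaves room only for \<open>u = c\<close> and
  \<open>w = 0\<close>.\<close>

lemma axial_system_locally_constant:
  fixes u w :: "complex \<Rightarrow> 'a::real_inner"
  assumes sys: "axial_system S u u0 u1 w w0 w1" and S: "open S" "z0 \<in> S" and Im: "Im z0 \<ge> 0"
    and max: "\<forall>\<^sub>F z in nhds z0. (norm (u z))\<^sup>2 + (norm (w z))\<^sup>2 \<le> (norm (u z0))\<^sup>2"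
  shows "\<forall>\<^sub>F z in nhds z0. Im z \<noteq> 0 \<longrightarrow> u z = u z0 \<and> w z = 0"
proof -
  define c where "c = u z0"
  obtain U where U: "open U" "z0 \<in> U" "\<And>z. z \<in> U \<Longrightarrow> (norm (u z))\<^sup>2 + (norm (w z))\<^sup>2 \<le> (norm c)\<^sup>2"
    using max unfolding eventually_nhds c_def by blast
  obtain R where R: "R > 0" "ball z0 R \<subseteq> S \<inter> U"
    using openE[of "S \<inter> U" z0] S U by blast
  have z0: "z0 \<in> ball z0 R" using R by simp
  have bound: "(norm (u z))\<^sup>2 + (norm (w z))\<^sup>2 \<le> (norm c)\<^sup>2" if "z \<in> ball z0 R" for z
    using U(3) R(2) that by blast
  have le: "u z \<bullet> c \<le> u z0 \<bullet> c" if "z \<in> ball z0 R" for z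
  proof -
    have "(norm (u z))\<^sup>2 \<le> (norm c)\<^sup>2"
      using bound[OF that] zero_le_power2[of "norm (w z)"] by linarith
    then have "norm (u z) \<le> norm c" by (rule power2_le_imp_le) simp
    then have "norm (u z) * norm c \<le> norm c * norm c" by (simp add: mult_right_mono)
    with norm_cauchy_schwarz[of "u z" c] show ?thesis
      by (simp add: c_def power2_norm_eq_inner[symmetric] power2_eq_square)
  qed
  have sys': "axial_system (ball z0 R) (\<lambda>z. u z \<bullet> c) (\<lambda>z. u0 z \<bullet> c) (\<lambda>z. u1 z \<bullet> c)
        (\<lambda>z. w z \<bullet> c) (\<lambda>z. w0 z \<bullet> c) (\<lambda>z. w1 z \<bullet> c)"
    using R(2) by (intro axial_system_linear_image[OF bounded_linear_inner_left] axial_system_subset[OF sys]) auto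
  have const: "Im z * (u z \<bullet> c - u z0 \<bullet> c) = 0" if z: "z \<in> ball z0 R" for z
  proof (cases "Im z0 = 0")
    case True
    then show ?thesis by (rule axial_system_real_max_imp_constant[OF sys' _ le z])
  next
    case False
    with Im have "z0 \<in> {z. Im z > 0}" by simp
    then have "\<forall>\<^sub>F z in nhds z0. z \<in> {z. Im z > 0}"
      by (intro eventually_nhds_in_open open_halfspace_Im_gt)
    moreover have "\<forall>\<^sub>F z in nhds z0. z \<in> ball z0 R"
      using z0 by (intro eventually_nhds_in_open) auto
    ultimately have "\<forall>\<^sub>F z in nhds z0. Im z * (u z \<bullet> c - u z0 \<bullet> c) \<le> Im z0 * (u z0 \<bullet> c - u z0 \<bullet> c)"
      by eventually_elim (use le in \<open>auto intro: mult_nonneg_nonpos\<close>)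
    from axial_system_max_imp_constant[OF sys' z0 this z] show ?thesis by simp
  qed
  have "u z = c \<and> w z = 0" if z: "z \<in> ball z0 R" "Im z \<noteq> 0" for z
  proof -
    have "u z \<bullet> c = (norm c)\<^sup>2"
      using const[OF z(1)] z(2) by (simp add: c_def power2_norm_eq_inner)
    \<comment> \<open>Expanding the square, the mixed term is known exactly from the constancy of
      \<open>u z \<bullet> c\<close>.\<close>
    then have "(norm (u z - c))\<^sup>2 = (norm (u z))\<^sup>2 - (norm c)\<^sup>2"
      by (simp add: power2_norm_eq_inner inner_diff_left inner_diff_right inner_commute)
    with bound[OF z(1)] have "(norm (u z - c))\<^sup>2 + (norm (w z))\<^sup>2 \<le> 0" by simp
    then show ?thesis by (simp add: sum_power2_le_zero_iff)
  qed
  moreover have "\<forall>\<^sub>F z in nhds z0. z \<in> ball z0 R"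
    using z0 by (intro eventually_nhds_in_open) auto
  ultimately show ?thesis unfolding c_def by (auto elim: eventually_mono)
qed

lemma slice_point_tendsto:
  "((\<lambda>z. oreal (Re z) + Im z *\<^sub>R I) \<longlongrightarrow> oreal (Re z0) + Im z0 *\<^sub>R I) (nhds z0)"
  unfolding oreal_def by (intro tendsto_intros filterlim_ident)

text \<open>Two ways of moving the point give opposite bounds on
  \<open>(I \<odot> w z0) \<bullet> c\<close>: inside the slice of \<open>I\<close> it is at most 0,
  and along the sphere it is at least the squared norm of \<open>w z0\<close>.\<close>

lemma stem_spherical_part_zero_at_max:
  fixes u w :: "complex \<Rightarrow> octo"
  assumes sys: "axial_system S u u0 u1 w w0 w1" and S: "open S" "z0 \<in> S" and Im: "Im z0 > 0"
    and I: "I \<in> imag_units"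
    and f: "\<And>z I. z \<in> S \<Longrightarrow> I \<in> imag_units \<Longrightarrow> f (oreal (Re z) + Im z *\<^sub>R I) = u z + I \<odot> w z"
    and max: "\<forall>\<^sub>F x in nhds (oreal (Re z0) + Im z0 *\<^sub>R I).
        (\<exists>z\<in>S. \<exists>J\<in>imag_units. x = oreal (Re z) + Im z *\<^sub>R J) \<longrightarrow> norm (f x) \<le> norm (u z0 + I \<odot> w z0)"
  shows "w z0 = 0"
proof -
  define c where "c = u z0 + I \<odot> w z0"
  have "\<forall>\<^sub>F z in nhds z0. z \<in> S" using S by (intro eventually_nhds_in_open)
  with max[THEN eventually_compose_filterlim, OF slice_point_tendsto]
  have "\<forall>\<^sub>F z in nhds z0. norm (u z + I \<odot> w z) \<le> norm c"
    by eventually_elim (use I f in \<open>auto simp: c_def\<close>)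
  then have max1: "\<forall>\<^sub>F z in nhds z0. u z \<bullet> c + (I \<odot> w z) \<bullet> c \<le> u z0 \<bullet> c + (I \<odot> w z0) \<bullet> c"
  proof eventually_elim
    case (elim z)
    have "(u z + I \<odot> w z) \<bullet> c \<le> norm c * norm c"
      using norm_cauchy_schwarz[of "u z + I \<odot> w z" c] mult_right_mono[OF elim, of "norm c"] by simp
    also have "\<dots> = (u z0 + I \<odot> w z0) \<bullet> c"
      by (simp flip: c_def add: power2_norm_eq_inner[symmetric] power2_eq_square)
    finally show ?case by (simp add: inner_add_left)
  qed
  obtain R where R: "R > 0" "ball z0 R \<subseteq> S" using openE[OF S] by blast
  have "bounded_linear (\<lambda>y. (I \<odot> y) \<bullet> c)"
    using bounded_linear_compose[OF bounded_linear_inner_left[of c] linear_conv_bounded_linear[THEN iffD1, OF linear_omul[of I]]]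
    by simp
  note sysB = axial_system_linear_image[OF this axial_system_subset[OF sys R(2)]]
  note sysA = axial_system_linear_image[OF bounded_linear_inner_left[of c] axial_system_subset[OF sys R(2)]]
  have b: "(I \<odot> w z0) \<bullet> c \<le> 0"
    by (rule axial_system_nonpos_at_max[OF sysA sysB R(1) Im max1])
  have "(I \<odot> w z0) \<bullet> u z0 \<ge> 0"
  proof (rule ccontr)
    \<comment> \<open>Otherwise turning \<open>I\<close> slightly towards a suitable
      \<open>J\<close> increases the norm of \<open>f\<close>: the negative term shrinks by
      \<open>cos t\<close>, and the sign of \<open>J\<close> makes the \<open>sin t\<close> term
      nonnegative.\<close>
    assume neg: "\<not> (I \<odot> w z0) \<bullet> u z0 \<ge> 0"
    obtain J where J: "J \<in> imag_units" "I \<bullet> J = 0" "(J \<odot> w z0) \<bullet> u z0 \<ge> 0"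
    proof -
      obtain J where J: "J \<in> imag_units" "I \<bullet> J = 0" using exists_orthogonal_imag_unit[OF I] by blast
      show ?thesis
      proof (cases "(J \<odot> w z0) \<bullet> u z0 \<ge> 0")
        case True
        then show ?thesis using J that by blast
      next
        case False
        then show ?thesis using J that[of "- J"] by (simp add: uminus_imag_unit omul_minus_left)
      qed
    qed
    define K where "K = (\<lambda>t. cos t *\<^sub>R I + sin t *\<^sub>R J)"
    have K: "K t \<in> imag_units" for t unfolding K_def by (rule cos_sin_imag_unit[OF I J(1,2)])
    have "((\<lambda>t. oreal (Re z0) + Im z0 *\<^sub>R K t) \<longlongrightarrow> oreal (Re z0) + Im z0 *\<^sub>R K 0) (nhds 0)"
      unfolding K_def by (intro tendsto_intros filterlim_ident)
    then have "((\<lambda>t. oreal (Re z0) + Im z0 *\<^sub>R K t) \<longlongrightarrow> oreal (Re z0) + Im z0 *\<^sub>R I) (nhds 0)"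
      by (simp add: K_def)
    from max[THEN eventually_compose_filterlim, OF this]
    have "\<forall>\<^sub>F t in nhds 0. norm (u z0 + K t \<odot> w z0) \<le> norm c"
      by eventually_elim (use K f[OF S(2) K] S(2) in \<open>metis c_def\<close>)
    then obtain e where e: "e > 0" "\<And>t. \<bar>t\<bar> < e \<Longrightarrow> norm (u z0 + K t \<odot> w z0) \<le> norm c"
      unfolding eventually_nhds_metric by (auto simp: dist_real_def)
    define t where "t = min (e / 2) 1"
    have t: "0 < t" "\<bar>t\<bar> < e" "t < pi" using e pi_gt3 by (auto simp: t_def)
    have sq: "(norm (u z0 + L \<odot> w z0))\<^sup>2 = (norm (u z0))\<^sup>2 + 2 * ((L \<odot> w z0) \<bullet> u z0) + (norm (w z0))\<^sup>2"
      if "L \<in> imag_units" for L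
      using norm_imag_unit_omul[OF that, of "w z0"]
      by (simp add: power2_norm_eq_inner norm_eq inner_add_left inner_add_right inner_commute)
    have "(norm (u z0 + K t \<odot> w z0))\<^sup>2 \<le> (norm c)\<^sup>2"
      using e(2)[OF t(2)] by (intro power_mono) auto
    then have "(K t \<odot> w z0) \<bullet> u z0 \<le> (I \<odot> w z0) \<bullet> u z0"
      unfolding c_def sq[OF K] sq[OF I] by simp
    then have "cos t * ((I \<odot> w z0) \<bullet> u z0) + sin t * ((J \<odot> w z0) \<bullet> u z0) \<le> (I \<odot> w z0) \<bullet> u z0"
      by (simp add: K_def omul_add_left omul_scaleR_left inner_add_left)
    moreover have "sin t * ((J \<odot> w z0) \<bullet> u z0) \<ge> 0"
      using sin_gt_zero[of t] t J(3) by simp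
    moreover have "cos t < 1" using cos_monotone_0_pi[of 0 t] t by simp
    then have "1 * ((I \<odot> w z0) \<bullet> u z0) < cos t * ((I \<odot> w z0) \<bullet> u z0)"
      using neg by (intro mult_strict_right_mono_neg) auto
    ultimately show False by simp
  qed
  moreover have "(I \<odot> w z0) \<bullet> c = (I \<odot> w z0) \<bullet> u z0 + (norm (w z0))\<^sup>2"
    using norm_imag_unit_omul[OF I, of "w z0"]
    by (simp add: c_def inner_add_right power2_norm_eq_inner norm_eq)
  ultimately have "(norm (w z0))\<^sup>2 \<le> 0" using b by linarith
  then show ?thesis by simp
qed

section \<open>Describing \<open>OmegaD D\<close> by the closed upper half plane\<close>

lemma slice_point_in_OmegaD:
  "(Re z, Im z) \<in> D \<Longrightarrow> I \<in> imag_units \<Longrightarrow> oreal (Re z) + Im z *\<^sub>R I \<in> OmegaD D"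
  unfolding OmegaD_def by blast

lemma OmegaD_upper_representation:
  assumes "\<forall>x0 x1. (x0, x1) \<in> D \<longrightarrow> (x0, - x1) \<in> D" "x \<in> OmegaD D"
  obtains z I where "(Re z, Im z) \<in> D" "Im z \<ge> 0" "I \<in> imag_units" "x = oreal (Re z) + Im z *\<^sub>R I"
proof -
  obtain x0 x1 I where x: "x = oreal x0 + x1 *\<^sub>R I" "(x0, x1) \<in> D" "I \<in> imag_units"
    using assms(2) by (auto simp: OmegaD_def)
  show ?thesis
  proof (cases "x1 \<ge> 0")
    case True
    then show ?thesis using x that[of "Complex x0 x1" I] by simp
  next
    case False
    then show ?thesis
      using x assms(1) that[of "Complex x0 (- x1)" "- I"] by (simp add: uminus_imag_unit)
  qed
qed

text \<open>This set is the image of \<open>OmegaD D\<close> under the continuous map sending an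
  octonion to its real part and the norm of its imaginary part.\<close>

lemma connected_upper_half:
  assumes "\<forall>x0 x1. (x0, x1) \<in> D \<longrightarrow> (x0, - x1) \<in> D" "connected (OmegaD D)"
  shows "connected {z. (Re z, Im z) \<in> D \<and> Im z \<ge> 0}"
proof -
  define \<pi> where "\<pi> = (\<lambda>x::octo. Complex (fst (fst x)) (norm (x - oreal (fst (fst x)))))"
  have \<pi>: "\<pi> (oreal (Re z) + Im z *\<^sub>R I) = z" if "Im z \<ge> 0" "I \<in> imag_units" for z I
  proof -
    have "fst (fst (oreal (Re z) + Im z *\<^sub>R I)) = Re z"
      using that(2) by (auto simp: oreal_def oone_def imag_units_iff)
    then show ?thesis using that by (simp add: \<pi>_def imag_units_iff complex_eq_iff)
  qed
  obtain I where I: "I \<in> imag_units" using imag_units_nonempty by blast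
  have "{z. (Re z, Im z) \<in> D \<and> Im z \<ge> 0} = \<pi> ` OmegaD D"
  proof (intro equalityI subsetI)
    fix z assume z: "z \<in> {z. (Re z, Im z) \<in> D \<and> Im z \<ge> 0}"
    then have "oreal (Re z) + Im z *\<^sub>R I \<in> OmegaD D" using I slice_point_in_OmegaD by simp
    then show "z \<in> \<pi> ` OmegaD D" using \<pi>[of z I] z I by (metis (no_types, lifting) image_eqI mem_Collect_eq)
  next
    fix z assume "z \<in> \<pi> ` OmegaD D"
    then obtain x where "x \<in> OmegaD D" "z = \<pi> x" by blast
    then show "z \<in> {z. (Re z, Im z) \<in> D \<and> Im z \<ge> 0}"
      using OmegaD_upper_representation[OF assms(1)] \<pi> by (metis (no_types, lifting) mem_Collect_eq)
  qed
  moreover have "continuous_on (OmegaD D) \<pi>"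
    unfolding \<pi>_def oreal_def Complex_eq by (intro continuous_intros)
  ultimately show ?thesis using connected_continuous_image assms(2) by metis
qed

text \<open>\<open>sph_deriv\<close> is a definite description over all stems and all
  representations of the point, so uniqueness has to be shown. Since \<open>f\<close> is constant on
  the sphere, comparing \<open>J\<close> with \<open>- J\<close> kills \<open>F2\<close> for any
  stem.\<close>

lemma spherical_part_zero_imp_sph_zero_set:
  assumes stem: "\<And>z I. (Re z, Im z) \<in> D \<Longrightarrow> I \<in> imag_units \<Longrightarrow> f (oreal (Re z) + Im z *\<^sub>R I) = u z + I \<odot> w z"
    and sym: "\<And>z. (Re z, Im z) \<in> D \<Longrightarrow> u (cnj z) = u z \<and> w (cnj z) = - w z"
    and z: "(Re z, Im z) \<in> D" "Im z \<noteq> 0" "w z = 0" and I: "I \<in> imag_units"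
  shows "oreal (Re z) + Im z *\<^sub>R I \<in> sph_zero_set D f"
proof -
  let ?x = "oreal (Re z) + Im z *\<^sub>R I"
  have \<Omega>: "?x \<in> OmegaD D" using z(1) I by (rule slice_point_in_OmegaD)
  have nonreal: "?x \<notin> range oreal"
    using oreal_add_imag_eqD(2)[of "Re z" "Im z" I _ 0 I] I z(2) by auto
  have fz: "f (oreal (Re z) + Im z *\<^sub>R K) = u z" if "K \<in> imag_units" for K
    using stem[OF z(1) that] z(3) by (simp add: omul_zero_right)
  have "is_stem D f (\<lambda>(x0, x1). u (Complex x0 x1)) (\<lambda>(x0, x1). w (Complex x0 x1))"
    unfolding is_stem_def
  proof (intro conjI allI impI)
    fix x0 x1 assume *: "(x0, x1) \<in> D"
    have "cnj (Complex x0 x1) = Complex x0 (- x1)" by (simp add: complex_eq_iff)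
    with sym[of "Complex x0 x1"] *
    show "(case (x0, - x1) of (x0, x1) \<Rightarrow> u (Complex x0 x1)) = (case (x0, x1) of (x0, x1) \<Rightarrow> u (Complex x0 x1))"
      "(case (x0, - x1) of (x0, x1) \<Rightarrow> w (Complex x0 x1)) = - (case (x0, x1) of (x0, x1) \<Rightarrow> w (Complex x0 x1))"
      by simp_all
    fix K assume "K \<in> imag_units"
    with stem[of "Complex x0 x1" K] *
    show "f (oreal x0 + x1 *\<^sub>R K) = (case (x0, x1) of (x0, x1) \<Rightarrow> u (Complex x0 x1)) +
        K \<odot> (case (x0, x1) of (x0, x1) \<Rightarrow> w (Complex x0 x1))"
      by simp
  qed
  moreover have "(1 / Im z) *\<^sub>R (case (Re z, Im z) of (x0, x1) \<Rightarrow> w (Complex x0 x1)) = 0"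
    using z(3) by simp
  ultimately have ex: "\<exists>F1 F2 x0 x1 J. is_stem D f F1 F2 \<and> (x0, x1) \<in> D \<and>
       J \<in> imag_units \<and> x1 \<noteq> 0 \<and> ?x = oreal x0 + x1 *\<^sub>R J \<and> 0 = (1 / x1) *\<^sub>R F2 (x0, x1)"
    using z I by metis
  have uniq: "v = 0" if v: "\<exists>F1 F2 x0 x1 J. is_stem D f F1 F2 \<and> (x0, x1) \<in> D \<and>
       J \<in> imag_units \<and> x1 \<noteq> 0 \<and> ?x = oreal x0 + x1 *\<^sub>R J \<and> v = (1 / x1) *\<^sub>R F2 (x0, x1)" for v
  proof -
    obtain F1 F2 x0 x1 J where F: "is_stem D f F1 F2" "(x0, x1) \<in> D" "J \<in> imag_units" "x1 \<noteq> 0"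
      "?x = oreal x0 + x1 *\<^sub>R J" "v = (1 / x1) *\<^sub>R F2 (x0, x1)"
      using v by blast
    have F12: "f (oreal x0 + x1 *\<^sub>R K) = F1 (x0, x1) + K \<odot> F2 (x0, x1)" if "K \<in> imag_units" for K
      using F(1,2) that unfolding is_stem_def by blast
    have x0: "Re z = x0" and "\<bar>Im z\<bar> = \<bar>x1\<bar>"
      using oreal_add_imag_eqD[OF F(5) I F(3)] .
    then have x1: "x1 = Im z \<or> x1 = - Im z" by linarith
    have fx: "f (oreal x0 + x1 *\<^sub>R K) = u z" if "K \<in> imag_units" for K
      using x1 fz[OF that] fz[OF uminus_imag_unit[OF that]] x0 by auto
    have "F1 (x0, x1) + J \<odot> F2 (x0, x1) = F1 (x0, x1) + (- J) \<odot> F2 (x0, x1)"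
      using F12[OF F(3)] F12[OF uminus_imag_unit[OF F(3)]] fx[OF F(3)] fx[OF uminus_imag_unit[OF F(3)]] by simp
    then have "J \<odot> F2 (x0, x1) + J \<odot> F2 (x0, x1) = 0"
      by (simp add: omul_minus_left eq_neg_iff_add_eq_0)
    then have "J \<odot> F2 (x0, x1) = 0" by (simp flip: scaleR_2)
    then have "norm (F2 (x0, x1)) = 0" using norm_imag_unit_omul[OF F(3), of "F2 (x0, x1)"] by simp
    then show ?thesis using F(6) by simp
  qed
  have "sph_deriv D f ?x = 0"
    unfolding sph_deriv_def by (rule the_equality) (rule ex, rule uniq)
  with \<Omega> nonreal show ?thesis by (simp add: sph_zero_set_def)
qed

theorem theorem2p37:
  fixes D :: "(real \<times> real) set" and f :: "octo \<Rightarrow> octo"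
  assumes "open D" and "D \<noteq> {}"
    and "\<forall>x0 x1. (x0, x1) \<in> D \<longrightarrow> (x0, - x1) \<in> D"
    and "connected (OmegaD D)"
    and "slice_fueter_regular D f"
    and "(\<exists>p\<in>OmegaD D. \<forall>x\<in>OmegaD D. norm (f x) \<le> norm (f p)) \<or>
         (\<exists>p\<in>OmegaD D - sph_zero_set D f. \<exists>e>0.
            \<forall>x\<in>OmegaD D \<inter> ball p e. norm (f x) \<le> norm (f p))"
  shows "\<exists>c. \<forall>x\<in>OmegaD D. f x = c"
proof -
  define S where "S = {z. (Re z, Im z) \<in> D}"
  obtain u u0 u1 w w0 w1 where sys: "axial_system S u u0 u1 w w0 w1"
    and parity: "\<And>z. (Re z, Im z) \<in> D \<Longrightarrow> u (cnj z) = u z \<and> w (cnj z) = - w z"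
    and stem: "\<And>z I. (Re z, Im z) \<in> D \<Longrightarrow> I \<in> imag_units \<Longrightarrow> f (oreal (Re z) + Im z *\<^sub>R I) = u z + I \<odot> w z"
    using slice_fueter_regular_imp_axial_system[OF assms(1,3,5)] unfolding S_def by blast
  have oS: "open S"
  proof -
    have "S = (\<lambda>z. (Re z, Im z)) -` D" by (auto simp: S_def)
    then show ?thesis using \<open>open D\<close> by (auto intro!: open_vimage continuous_intros)
  qed
  have \<Omega>: "(\<exists>z\<in>S. \<exists>J\<in>imag_units. x = oreal (Re z) + Im z *\<^sub>R J) \<longleftrightarrow> x \<in> OmegaD D" for x
  proof
    assume "x \<in> OmegaD D"
    then show "\<exists>z\<in>S. \<exists>J\<in>imag_units. x = oreal (Re z) + Im z *\<^sub>R J"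
      using OmegaD_upper_representation[OF assms(3)] unfolding S_def by (metis (no_types, lifting) mem_Collect_eq)
  qed (use slice_point_in_OmegaD in \<open>auto simp: S_def simp del: split_paired_Ex split_paired_All split_paired_Bex_Sigma\<close>)
  \<comment> \<open>Both alternatives yield a local maximum; \<open>alt\<close> records what is
    needed to control the antipodal point later.\<close>
  obtain p where p: "p \<in> OmegaD D"
    and local_max: "\<forall>\<^sub>F x in nhds p. x \<in> OmegaD D \<longrightarrow> norm (f x) \<le> norm (f p)"
    and alt: "(\<forall>x\<in>OmegaD D. norm (f x) \<le> norm (f p)) \<or> p \<notin> sph_zero_set D f"
    using assms(6)
  proof (elim disjE bexE exE conjE)
    fix p assume "p \<in> OmegaD D" "\<forall>x\<in>OmegaD D. norm (f x) \<le> norm (f p)"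
    then show thesis using that[of p] by (simp add: always_eventually)
  next
    fix p e assume p: "p \<in> OmegaD D - sph_zero_set D f" and "e > 0"
      and *: "\<forall>x\<in>OmegaD D \<inter> ball p e. norm (f x) \<le> norm (f p)"
    have "\<forall>\<^sub>F x in nhds p. x \<in> ball p e" using \<open>e > 0\<close> by (intro eventually_nhds_in_open) auto
    then have "\<forall>\<^sub>F x in nhds p. x \<in> OmegaD D \<longrightarrow> norm (f x) \<le> norm (f p)"
      by eventually_elim (use * in auto)
    then show thesis using that[of p] p by blast
  qed
  obtain z0 I where z0: "(Re z0, Im z0) \<in> D" "Im z0 \<ge> 0" and I: "I \<in> imag_units"
    and p_eq: "p = oreal (Re z0) + Im z0 *\<^sub>R I"
    using OmegaD_upper_representation[OF assms(3) p] by blast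
  have z0S: "z0 \<in> S" using z0 by (simp add: S_def)
  have fp: "f p = u z0 + I \<odot> w z0" using stem[OF z0(1) I] p_eq by simp
  have w0: "w z0 = 0"
  proof (cases "Im z0 = 0")
    case True
    moreover have "Im z0 *\<^sub>R u0 z0 = Im z0 *\<^sub>R w1 z0 + 2 *\<^sub>R w z0"
      using sys z0S unfolding axial_system_def by blast
    ultimately show ?thesis by simp
  next
    case False
    show ?thesis
    proof (rule stem_spherical_part_zero_at_max[OF sys oS z0S _ I])
      show "Im z0 > 0" using False z0 by simp
      show "f (oreal (Re z) + Im z *\<^sub>R J) = u z + J \<odot> w z" if "z \<in> S" "J \<in> imag_units" for z J
        using stem that by (simp add: S_def)
      show "\<forall>\<^sub>F x in nhds (oreal (Re z0) + Im z0 *\<^sub>R I).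
        (\<exists>z\<in>S. \<exists>J\<in>imag_units. x = oreal (Re z) + Im z *\<^sub>R J) \<longrightarrow> norm (f x) \<le> norm (u z0 + I \<odot> w z0)"
        unfolding \<Omega> using local_max by (simp add: p_eq[symmetric] fp[symmetric])
    qed
  qed
  then have fp': "f p = u z0" using fp by (simp add: omul_zero_right)
  have \<Omega>I: "oreal (Re z) + Im z *\<^sub>R K \<in> OmegaD D" if "z \<in> S" "K \<in> imag_units" for z K
    using that by (simp add: S_def slice_point_in_OmegaD)
  have evS: "\<forall>\<^sub>F z in nhds z0. z \<in> S" using oS z0S by (rule eventually_nhds_in_open)
  \<comment> \<open>For \<open>K = - I\<close> and \<open>Im z0 \<noteq> 0\<close> the slice point
    is far from \<open>p\<close>, where local maximality says nothing. But \<open>w z0 = 0\<close>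
    then puts \<open>p\<close> into the zero set, so \<open>alt\<close> leaves only a global
    maximum.\<close>
  have ev: "\<forall>\<^sub>F z in nhds z0. norm (f (oreal (Re z) + Im z *\<^sub>R K)) \<le> norm (u z0)"
    if K: "K = I \<or> K = - I" for K
  proof -
    have KI: "K \<in> imag_units" using K I uminus_imag_unit by blast
    have "\<forall>\<^sub>F z in nhds z0. oreal (Re z) + Im z *\<^sub>R K \<in> OmegaD D \<longrightarrow>
        norm (f (oreal (Re z) + Im z *\<^sub>R K)) \<le> norm (f p)"
    proof (cases "K = I \<or> Im z0 = 0")
      case True
      then have "p = oreal (Re z0) + Im z0 *\<^sub>R K" using p_eq by auto
      with eventually_compose_filterlim[OF local_max] slice_point_tendsto[of K z0]
      show ?thesis by simp
    next
      case False
      then have "p \<in> sph_zero_set D f"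
        unfolding p_eq by (intro spherical_part_zero_imp_sph_zero_set[OF stem parity z0(1) _ w0 I]) auto
      with alt show ?thesis by (simp add: always_eventually)
    qed
    with evS show ?thesis by eventually_elim (use \<Omega>I KI fp' in auto)
  qed
  have "\<forall>\<^sub>F z in nhds z0. (norm (u z))\<^sup>2 + (norm (w z))\<^sup>2 \<le> (norm (u z0))\<^sup>2"
    using evS ev[of I, simplified] ev[of "- I", simplified]
  proof eventually_elim
    case (elim z)
    have "f (oreal (Re z) + Im z *\<^sub>R I) = u z + I \<odot> w z" "f (oreal (Re z) - Im z *\<^sub>R I) = u z - I \<odot> w z"
      using stem[of z I] stem[of z "- I"] elim(1) I uminus_imag_unit[OF I] by (simp_all add: S_def omul_minus_left)
    with elim have "(norm (u z + I \<odot> w z))\<^sup>2 \<le> (norm (u z0))\<^sup>2" "(norm (u z - I \<odot> w z))\<^sup>2 \<le> (norm (u z0))\<^sup>2"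
      by (simp_all add: power_mono)
    \<comment> \<open>Parallelogram identity: averaging the bounds for \<open>I\<close> and
      \<open>- I\<close> removes the mixed term.\<close>
    moreover have "(norm (u z + I \<odot> w z))\<^sup>2 + (norm (u z - I \<odot> w z))\<^sup>2 = 2 * (norm (u z))\<^sup>2 + 2 * (norm (w z))\<^sup>2"
      using norm_imag_unit_omul[OF I, of "w z"]
      by (simp add: power2_norm_eq_inner norm_eq inner_add_left inner_add_right inner_diff_left inner_diff_right inner_commute)
    ultimately show ?case by linarith
  qed
  from axial_system_locally_constant[OF sys oS z0S z0(2) this]
  have near: "\<forall>\<^sub>F y in nhds z0. Im y \<noteq> 0 \<longrightarrow> u y = u z0 \<and> w y = 0" .
  define near_const where "near_const = (\<lambda>z. \<forall>\<^sub>F y in nhds z. Im y \<noteq> 0 \<longrightarrow> u y = u z0 \<and> w y = 0)"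
  have propagate: "u z = u z0 \<and> w z = 0"
    if "ball a R \<subseteq> S" "y \<in> ball a R" "near_const y" "z \<in> ball a R" for a R y z
    using axial_system_continuation_inner[OF sys that(1,2) that(3)[unfolded near_const_def] that(4)] .
  let ?U = "{z. (Re z, Im z) \<in> D \<and> Im z \<ge> 0}"
  have stem_const: "u z = u z0 \<and> w z = 0" if z: "z \<in> ?U" for z
  proof -
    have "near_const z"
    \<comment> \<open>Balls inside \<open>S\<close> may cross the real axis, which continuation
      permits, so the induction also passes real points of the closed upper half.\<close>
    proof (rule connected_induction_simple[OF connected_upper_half[OF assms(3,4)], of z0])
      show "z0 \<in> ?U" "z \<in> ?U" "near_const z0" using z0 z near by (auto simp: near_const_def)
      fix a assume "a \<in> ?U"
      then obtain R where R: "R > 0" "ball a R \<subseteq> S" using openE[OF oS, of a] by (auto simp: S_def)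
      have "near_const y" if "x \<in> ball a R" "near_const x" "y \<in> ball a R" for x y
        using eventually_nhds_in_open[OF open_ball that(3)] unfolding near_const_def
        by eventually_elim (use propagate[OF R(2) that(1,2)] in blast)
      then show "\<exists>T. openin (top_of_set ?U) T \<and> a \<in> T \<and> (\<forall>x\<in>T. \<forall>y\<in>T. near_const x \<longrightarrow> near_const y)"
        by (intro exI[of _ "?U \<inter> ball a R"] conjI openin_open_Int open_ball)
          (use R(1) \<open>a \<in> ?U\<close> in \<open>simp, blast\<close>)
    qed
    moreover obtain R where "R > 0" "ball z R \<subseteq> S" using openE[OF oS, of z] z by (auto simp: S_def)
    ultimately show ?thesis by (intro propagate[of z R z z]) simp_all
  qed
  have "f x = u z0" if "x \<in> OmegaD D" for x
  proof -
    obtain z I where z: "(Re z, Im z) \<in> D" "Im z \<ge> 0" "I \<in> imag_units" "x = oreal (Re z) + Im z *\<^sub>R I"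
      using OmegaD_upper_representation[OF assms(3) \<open>x \<in> OmegaD D\<close>] by blast
    then show ?thesis using stem[OF z(1,3)] stem_const[of z] by (simp add: omul_zero_right)
  qed
  then show ?thesis by blast
qed

end
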